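(* There is a canonical bijection between (isomorphism classes of) finitary colored upho posets and (isomorphism classes of) atomic, left-cancellative, invertible-free monoids, given by the mutually inverse assignments $\tilde P\mapsto\mathcal{M}(\tilde P)$ and $M\mapsto\tilde{\mathcal{P}}(M)$. Moreover, this bijection maps $\mathbb{N}$-graded colored upho posets to left-cancellative homogeneous monoids, and maps finite type $\mathbb{N}$-graded colored upho posets to finitely generated left-cancellative homogeneous monoids (giving bijections between these respective subclasses).
   Context: Posets. For a poset $P$ and $s\in P$, let $V_s=\{p\in P:s\le p\}$ with the induced order. A (nonempty) poset $P$ is upho if $V_s\cong P$ for every $s\in P$; it then has a least element $\hat 0$. Write $s\lessdot t$ for covering, $\mathcal{E}_P=\{(r,s):r\lessdot s\}$ for the set of edges, and $\mathcal{A}_P=\{s:\hat 0\lessdot s\}$ for the set of atoms. $P$ is finitary if for every $s\in P$ there is a finite saturated chain from $\hat 0$ to $s$. $P$ is $\mathbb{N}$-graded if $P=P_0\sqcup P_1\sqcup\cdots$ so that every maximal chain has the form $p_0\lessdot p_1\lessdot p_2\lessdot\cdots$ with $p_i\in P_i$; it is of finite type if all $P_i$ are finite. A colored upho poset $\tilde P=(P,\mathrm{col}_P)$ is an upho poset $P$ with a map $\mathrm{col}_P:\mathcal{E}_P\to\mathcal{A}_P$ such that (i) $\mathrm{col}_P(\hat 0,t)=t$ for all $t\in\mathcal{A}_P$; (ii) for every $s\in P$ there is a poset isomorphism $\phi_s:V_s\to P$ with $\mathrm{col}_P(u,v)=\mathrm{col}_P(\phi_s(u),\phi_s(v))$ for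 all $(u,v)\in\mathcal{E}_{V_s}$ (for finitary $P$, $\phi_s$ is unique). $\tilde P$ is called finitary, $\mathbb{N}$-graded, or of finite type if $P$ is. An isomorphism of colored upho posets is a poset isomorphism $\sigma$ with $\mathrm{col}(\sigma(u),\sigma(v))=\sigma(\mathrm{col}(u,v))$. Monoids. A monoid $M$ with identity $e$ is left-cancellative if $ax=ay$ implies $x=y$; invertible-free if $xy=e$ implies $x=y=e$. An element is irreducible if it is not invertible and is not a product of two non-invertible elements; $\mathcal{I}_M$ is the set of irreducible elements. $M$ is atomic if every element is a finite (possibly empty) product of irreducibles. $M$ is homogeneous if it is atomic and any two factorizations $a_1\cdots a_n=b_1\cdots b_m$ of the same element into irreducibles have $n=m$ (homogeneous monoids are invertible-free). The assignments. For a finitary colored upho poset $\tilde P$, $\mathcal{M}(\tilde P)$ is the set $P$ with multiplication $st=\phi_s^{-1}(t)$. For an atomic, left-cancellative, invertible-free monoid $M$, $\tilde{\mathcal{P}}(M)$ is the set $M$ with the order $a\le b$ iff $ac=b$ for some $c\in M$, where an edge $a\lessdot b$ gets as color the unique $c\in\mathcal{I}_M$ with $ac=b$. *)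

theory Defs
  imports "HOL-Algebra.Group" "HOL-Library.Disjoint_Sets"
begin

section \<open>Upho posets\<close>

record 'a poset = "'a partial_object" +
  leq :: "'a rel"

definition poset :: "('a, 'm) poset_scheme \<Rightarrow> bool" where
  "poset P \<longleftrightarrow> partial_order_on (carrier P) (leq P)"

definition poset_isos :: "('a, 'm) poset_scheme \<Rightarrow> ('b, 'n) poset_scheme \<Rightarrow> ('a \<Rightarrow> 'b) set" where
  "poset_isos P Q = {f. bij_betw f (carrier P) (carrier Q) \<and>
     (\<forall>x\<in>carrier P. \<forall>y\<in>carrier P. (x, y) \<in> leq P \<longleftrightarrow> (f x, f y) \<in> leq Q)}"

definition above :: "('a, 'm) poset_scheme \<Rightarrow> 'a \<Rightarrow> ('a, 'm) poset_scheme" where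
  "above P s = (let V = {p \<in> carrier P. (s, p) \<in> leq P}
     in P\<lparr>carrier := V, leq := leq P \<inter> V \<times> V\<rparr>)"

definition upho :: "('a, 'm) poset_scheme \<Rightarrow> bool" where
  "upho P \<longleftrightarrow> poset P \<and> carrier P \<noteq> {} \<and> (\<forall>s\<in>carrier P. poset_isos (above P s) P \<noteq> {})"

definition least_elt :: "('a, 'm) poset_scheme \<Rightarrow> 'a" where
  "least_elt P = (THE z. z \<in> carrier P \<and> (\<forall>x\<in>carrier P. (z, x) \<in> leq P))"

definition edges :: "('a, 'm) poset_scheme \<Rightarrow> 'a rel" where
  "edges P = {(r, s). r \<in> carrier P \<and> s \<in> carrier P \<and> (r, s) \<in> leq P \<and> r \<noteq> s \<and>
     \<not> (\<exists>x\<in>carrier P. x \<noteq> r \<and> x \<noteq> s \<and> (r, x) \<in> leq P \<and> (x, s) \<in> leq P)}"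

definition atoms :: "('a, 'm) poset_scheme \<Rightarrow> 'a set" where
  "atoms P = {s. (least_elt P, s) \<in> edges P}"

definition finitary :: "('a, 'm) poset_scheme \<Rightarrow> bool" where
  "finitary P \<longleftrightarrow> (\<forall>s\<in>carrier P. \<exists>xs. xs \<noteq> [] \<and> hd xs = least_elt P \<and> last xs = s \<and>
     successively (\<lambda>x y. (x, y) \<in> edges P) xs)"

text \<open>In a one-element upho poset the only maximal chain is finite, so the index set of a
  maximal chain is allowed to be an initial segment \<open>{..n}\<close> of the natural numbers. An upho poset
  with more than one element has no maximal elements, hence no finite maximal chains, and there the
  index set is always \<open>UNIV\<close>. The rank sets \<open>R i\<close> may be empty.\<close>

definition is_grading :: "('a, 'm) poset_scheme \<Rightarrow> (nat \<Rightarrow> 'a set) \<Rightarrow> bool" where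
  "is_grading P R \<longleftrightarrow> carrier P = (\<Union>i. R i) \<and> disjoint_family R \<and>
     (\<forall>C. pred_on.maxchain (carrier P) (\<lambda>x y. (x, y) \<in> leq P) C \<longrightarrow>
       (\<exists>I p. (I = UNIV \<or> (\<exists>n. I = {..n})) \<and> C = p ` I \<and> (\<forall>i\<in>I. p i \<in> R i) \<and>
          (\<forall>i. Suc i \<in> I \<longrightarrow> (p i, p (Suc i)) \<in> edges P)))"

definition N_graded :: "('a, 'm) poset_scheme \<Rightarrow> bool" where
  "N_graded P \<longleftrightarrow> (\<exists>R. is_grading P R)"

definition finite_type_N_graded :: "('a, 'm) poset_scheme \<Rightarrow> bool" where
  "finite_type_N_graded P \<longleftrightarrow> (\<exists>R. is_grading P R \<and> (\<forall>i. finite (R i)))"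


section \<open>Colored upho posets\<close>

text \<open>Only the values of \<open>col\<close> on edges are meaningful.\<close>

record 'a colored_poset = "'a poset" +
  col :: "'a \<Rightarrow> 'a \<Rightarrow> 'a"

definition shift_isos :: "('a, 'm) colored_poset_scheme \<Rightarrow> 'a \<Rightarrow> ('a \<Rightarrow> 'a) set" where
  "shift_isos P s = {\<phi> \<in> poset_isos (above P s) P.
     \<forall>(u, v)\<in>edges (above P s). col P u v = col P (\<phi> u) (\<phi> v)}"

definition colored_upho :: "('a, 'm) colored_poset_scheme \<Rightarrow> bool" where
  "colored_upho P \<longleftrightarrow> upho P \<and>
     (\<forall>(r, s)\<in>edges P. col P r s \<in> atoms P) \<and>
     (\<forall>t\<in>atoms P. col P (least_elt P) t = t) \<and>
     (\<forall>s\<in>carrier P. shift_isos P s \<noteq> {})"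

text \<open>Unlike the maps \<open>\<phi>\<^sub>s\<close>, which preserve colors exactly, an isomorphism of colored upho posets
  transports the colors, since these are themselves elements of the poset.\<close>

definition colored_isos ::
    "('a, 'm) colored_poset_scheme \<Rightarrow> ('b, 'n) colored_poset_scheme \<Rightarrow> ('a \<Rightarrow> 'b) set" where
  "colored_isos P Q = {\<sigma> \<in> poset_isos P Q.
     \<forall>(u, v)\<in>edges P. col Q (\<sigma> u) (\<sigma> v) = \<sigma> (col P u v)}"

text \<open>For finitary \<open>P\<close> the map \<open>\<phi>\<^sub>s\<close> is unique as a function on \<open>V\<^sub>s\<close>; restricting to extensional
  functions makes it unique as a HOL function.\<close>

definition shift_iso :: "('a, 'm) colored_poset_scheme \<Rightarrow> 'a \<Rightarrow> 'a \<Rightarrow> 'a" where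
  "shift_iso P s = (THE \<phi>. \<phi> \<in> shift_isos P s \<and> \<phi> \<in> extensional (carrier (above P s)))"


section \<open>Monoids\<close>

definition left_cancellative :: "('a, 'm) monoid_scheme \<Rightarrow> bool" where
  "left_cancellative M \<longleftrightarrow> (\<forall>a\<in>carrier M. \<forall>x\<in>carrier M. \<forall>y\<in>carrier M.
     a \<otimes>\<^bsub>M\<^esub> x = a \<otimes>\<^bsub>M\<^esub> y \<longrightarrow> x = y)"

definition invertible_free :: "('a, 'm) monoid_scheme \<Rightarrow> bool" where
  "invertible_free M \<longleftrightarrow> (\<forall>x\<in>carrier M. \<forall>y\<in>carrier M.
     x \<otimes>\<^bsub>M\<^esub> y = \<one>\<^bsub>M\<^esub> \<longrightarrow> x = \<one>\<^bsub>M\<^esub> \<and> y = \<one>\<^bsub>M\<^esub>)"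

definition irreducibles :: "('a, 'm) monoid_scheme \<Rightarrow> 'a set" where
  "irreducibles M = {a \<in> carrier M. a \<notin> Units M \<and>
     \<not> (\<exists>b\<in>carrier M - Units M. \<exists>c\<in>carrier M - Units M. a = b \<otimes>\<^bsub>M\<^esub> c)}"

definition list_prod :: "('a, 'm) monoid_scheme \<Rightarrow> 'a list \<Rightarrow> 'a" where
  "list_prod M as = foldr (mult M) as \<one>\<^bsub>M\<^esub>"

definition atomic :: "('a, 'm) monoid_scheme \<Rightarrow> bool" where
  "atomic M \<longleftrightarrow> (\<forall>x\<in>carrier M. \<exists>as. set as \<subseteq> irreducibles M \<and> list_prod M as = x)"

definition homogeneous :: "('a, 'm) monoid_scheme \<Rightarrow> bool" where
  "homogeneous M \<longleftrightarrow> atomic M \<and>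
     (\<forall>as bs. set as \<subseteq> irreducibles M \<and> set bs \<subseteq> irreducibles M \<and>
        list_prod M as = list_prod M bs \<longrightarrow> length as = length bs)"

definition finitely_generated :: "('a, 'm) monoid_scheme \<Rightarrow> bool" where
  "finitely_generated M \<longleftrightarrow> (\<exists>G. finite G \<and> G \<subseteq> carrier M \<and>
     (\<forall>x\<in>carrier M. \<exists>as. set as \<subseteq> G \<and> list_prod M as = x))"


section \<open>The two assignments\<close>

definition monoid_of :: "'a colored_poset \<Rightarrow> 'a monoid" where
  "monoid_of P = \<lparr>carrier = carrier P,
     mult = (\<lambda>s t. inv_into (carrier (above P s)) (shift_iso P s) t),
     one = least_elt P\<rparr>"

definition poset_of :: "'a monoid \<Rightarrow> 'a colored_poset" where
  "poset_of M = \<lparr>carrier = carrier M,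
     leq = {(a, b). a \<in> carrier M \<and> b \<in> carrier M \<and> (\<exists>c\<in>carrier M. a \<otimes>\<^bsub>M\<^esub> c = b)},
     col = (\<lambda>a b. THE c. c \<in> irreducibles M \<and> a \<otimes>\<^bsub>M\<^esub> c = b)\<rparr>"


section \<open>Classes of structures and isomorphism classes\<close>

definition finitary_colored_uphos :: "'a colored_poset set" where
  "finitary_colored_uphos = {P. colored_upho P \<and> finitary P}"

definition N_graded_colored_uphos :: "'a colored_poset set" where
  "N_graded_colored_uphos = {P. colored_upho P \<and> N_graded P}"

definition finite_type_N_graded_colored_uphos :: "'a colored_poset set" where
  "finite_type_N_graded_colored_uphos = {P. colored_upho P \<and> finite_type_N_graded P}"

definition atomic_lcif_monoids :: "'a monoid set" where
  "atomic_lcif_monoids = {M. monoid M \<and> atomic M \<and> left_cancellative M \<and> invertible_free M}"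

definition homogeneous_lc_monoids :: "'a monoid set" where
  "homogeneous_lc_monoids = {M. monoid M \<and> left_cancellative M \<and> homogeneous M}"

definition fg_homogeneous_lc_monoids :: "'a monoid set" where
  "fg_homogeneous_lc_monoids =
     {M. monoid M \<and> finitely_generated M \<and> left_cancellative M \<and> homogeneous M}"

text \<open>Isomorphism classes of structures carried by subsets of a type are the elements of the
  quotients by the following relations. Two structures that differ only in values outside their
  carriers (or in colors of non-edges) are isomorphic.\<close>

definition upho_iso_rel :: "'a colored_poset rel" where
  "upho_iso_rel = {(P, Q). colored_upho P \<and> colored_upho Q \<and> colored_isos P Q \<noteq> {}}"

definition monoid_iso_rel :: "'a monoid rel" where
  "monoid_iso_rel = {(M, N). monoid M \<and> monoid N \<and> is_iso M N}"

text \<open>The map on equivalence classes induced by \<open>F\<close>. The result is a single \<open>R\<close>-class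
  when \<open>F\<close> sends all elements of \<open>C\<close> into one class.\<close>

definition on_classes :: "'b rel \<Rightarrow> ('a \<Rightarrow> 'b) \<Rightarrow> 'a set \<Rightarrow> 'b set" where
  "on_classes R F C = (\<Union>x\<in>C. R `` {F x})"

end

theory Submission
  imports Defs
begin

text \<open>
  A shift isomorphism \<open>\<phi>\<^sub>u\<close> sends an edge \<open>(u, v)\<close> to the edge from the least element to an atom, and
  that atom is its own color; so \<open>\<phi>\<^sub>u v\<close> is the color of \<open>(u, v)\<close>. Hence edges leaving a common
  vertex have distinct colors, and induction along saturated chains from the least element shows that
  \<open>\<phi>\<^sub>s\<close> is unique. Uniqueness gives \<open>\<phi>\<^sub>t \<circ> \<phi>\<^sub>s = \<phi>\<^bsub>st\<^esub>\<close> on \<open>V\<^bsub>st\<^esub>\<close>, which is associativity, and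
  \<open>\<sigma> \<circ> \<phi>\<^sub>s \<circ> \<sigma>\<inverse> = \<phi>\<^bsub>\<sigma> s\<^esub>\<close> for a colored isomorphism \<open>\<sigma>\<close>, which is multiplicativity of \<open>\<sigma>\<close>. Conversely, in a
  left-cancellative monoid the inverse of left multiplication by \<open>s\<close> serves as \<open>\<phi>\<^sub>s\<close>. Both round trips are
  the identity on the underlying set.

  Saturated chains of length \<open>n\<close> from the identity to \<open>x\<close> are factorizations of \<open>x\<close> into \<open>n\<close>
  irreducibles. In a graded poset such a chain extends to a maximal chain, of which it is an initial
  segment, so the rank of \<open>x\<close> determines \<open>n\<close>. Conversely, the lengths of the elements of a maximal chain
  in the divisibility order of a homogeneous monoid cannot skip a value, so length is a grading.
\<close>

section \<open>Posets\<close>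

lemma poset_refl: "poset P \<Longrightarrow> x \<in> carrier P \<Longrightarrow> (x, x) \<in> leq P"
  by (auto simp: poset_def order_on_defs refl_on_def)

lemma poset_antisym: "poset P \<Longrightarrow> (x, y) \<in> leq P \<Longrightarrow> (y, x) \<in> leq P \<Longrightarrow> x = y"
  by (auto simp: poset_def order_on_defs antisym_def)

lemma poset_trans: "poset P \<Longrightarrow> (x, y) \<in> leq P \<Longrightarrow> (y, z) \<in> leq P \<Longrightarrow> (x, z) \<in> leq P"
  by (auto simp: poset_def order_on_defs dest: transD)

lemma poset_leq_carrier:
  "poset P \<Longrightarrow> (x, y) \<in> leq P \<Longrightarrow> x \<in> carrier P"
  "poset P \<Longrightarrow> (x, y) \<in> leq P \<Longrightarrow> y \<in> carrier P"
  by (auto simp: poset_def order_on_defs)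

lemma edges_leq: "(x, y) \<in> edges P \<Longrightarrow> (x, y) \<in> leq P"
  by (simp add: edges_def)

lemma edges_neq: "(x, y) \<in> edges P \<Longrightarrow> x \<noteq> y"
  by (simp add: edges_def)

lemma edges_carrier:
  "(x, y) \<in> edges P \<Longrightarrow> x \<in> carrier P"
  "(x, y) \<in> edges P \<Longrightarrow> y \<in> carrier P"
  by (simp_all add: edges_def)

lemma edges_between:
  "(x, z) \<in> edges P \<Longrightarrow> y \<in> carrier P \<Longrightarrow> (x, y) \<in> leq P \<Longrightarrow> (y, z) \<in> leq P \<Longrightarrow> y = x \<or> y = z"
  by (auto simp: edges_def)

section \<open>Principal filters\<close>

lemma carrier_above: "carrier (above P s) = {p \<in> carrier P. (s, p) \<in> leq P}"
  by (simp add: above_def Let_def)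

lemma leq_above: "leq (above P s) = leq P \<inter> carrier (above P s) \<times> carrier (above P s)"
  by (simp add: above_def Let_def)

text \<open>Lets a shift isomorphism at \<open>s\<close> be restricted to the smaller filter of an
  element \<open>a\<close> above \<open>s\<close>.\<close>

lemma above_above:
  assumes "poset P" "(s, a) \<in> leq P"
  shows "above (above P s) a = above P a"
proof -
  \<comment> \<open>\<open>above\<close> changes only the fields \<open>carrier\<close> and
    \<open>leq\<close>, so equality of the records comes down to these two; any further fields, such
    as colors, are carried along.\<close>
  have eq: "above Q t = Q\<lparr>carrier := carrier (above Q t), leq := leq (above Q t)\<rparr>"
    for Q :: "('c, 'd) poset_scheme" and t
    by (simp add: above_def Let_def)
  have c: "carrier (above (above P s) a) = carrier (above P a)"
    using assms poset_trans[OF assms] poset_leq_carrier[OF assms]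
    unfolding carrier_above leq_above by blast
  moreover have "leq (above (above P s) a) = leq (above P a)"
    unfolding leq_above[of "above P s"] c unfolding leq_above
    using poset_trans[OF assms] unfolding carrier_above by blast
  ultimately have "above (above P s) a
      = (above P s)\<lparr>carrier := carrier (above P a), leq := leq (above P a)\<rparr>"
    using eq[of "above P s" a] by metis
  also have "\<dots> = P\<lparr>carrier := carrier (above P a), leq := leq (above P a)\<rparr>"
    by (subst eq[of P s]) simp
  finally show ?thesis using eq[of P a] by simp
qed

text \<open>A filter is convex: whatever lies between two of its elements belongs to it, so
  restricting to the filter creates no new covers.\<close>

lemma edges_above:
  assumes "poset P"
  shows "edges (above P s) = edges P \<inter> carrier (above P s) \<times> carrier (above P s)"
  using poset_trans[OF assms]
  unfolding edges_def leq_above carrier_above by blast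

section \<open>Poset isomorphisms\<close>

lemma poset_isosD:
  assumes "f \<in> poset_isos P Q"
  shows "bij_betw f (carrier P) (carrier Q)"
    and "x \<in> carrier P \<Longrightarrow> y \<in> carrier P \<Longrightarrow> (f x, f y) \<in> leq Q \<longleftrightarrow> (x, y) \<in> leq P"
    and "x \<in> carrier P \<Longrightarrow> f x \<in> carrier Q"
  using assms by (auto simp: poset_isos_def bij_betw_def)

lemma poset_isos_surj:
  assumes "f \<in> poset_isos P Q" "y \<in> carrier Q"
  obtains x where "x \<in> carrier P" "y = f x"
  using assms bij_betw_imp_surj_on[OF poset_isosD(1)] by blast

lemma poset_isos_inv:
  assumes f: "f \<in> poset_isos P Q"
  shows "inv_into (carrier P) f \<in> poset_isos Q P"
proof -
  note b = poset_isosD(1)[OF f]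
  have "(inv_into (carrier P) f x, inv_into (carrier P) f y) \<in> leq P \<longleftrightarrow> (x, y) \<in> leq Q"
    if "x \<in> carrier Q" "y \<in> carrier Q" for x y
    using that poset_isosD(2)[OF f, of "inv_into (carrier P) f x" "inv_into (carrier P) f y"]
      bij_betw_inv_into_right[OF b] bij_betw_apply[OF bij_betw_inv_into[OF b]] by simp
  then show ?thesis
    by (simp add: poset_isos_def bij_betw_inv_into[OF b])
qed

lemma poset_isos_comp:
  "f \<in> poset_isos P Q \<Longrightarrow> g \<in> poset_isos Q R \<Longrightarrow> g \<circ> f \<in> poset_isos P R"
  by (auto simp: poset_isos_def bij_betw_trans bij_betw_apply)

lemma poset_isos_edges:
  assumes f: "f \<in> poset_isos P Q" and "x \<in> carrier P" "y \<in> carrier P"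
  shows "(f x, f y) \<in> edges Q \<longleftrightarrow> (x, y) \<in> edges P"
proof -
  have Q: "carrier Q = f ` carrier P" and inj: "inj_on f (carrier P)"
    using f by (auto simp: poset_isos_def bij_betw_def)
  show ?thesis
    using assms(2,3) unfolding edges_def Q
    by (auto simp: poset_isosD(2)[OF f] inj_on_eq_iff[OF inj])
qed

lemma poset_isos_above:
  assumes f: "f \<in> poset_isos P Q" and a: "a \<in> carrier P"
  shows "f \<in> poset_isos (above P a) (above Q (f a))"
proof -
  have "f ` carrier (above P a) = carrier (above Q (f a))"
  proof
    show "carrier (above Q (f a)) \<subseteq> f ` carrier (above P a)"
    proof
      fix y assume y: "y \<in> carrier (above Q (f a))"
      then obtain x where "x \<in> carrier P" "y = f x"
        using poset_isos_surj[OF f] unfolding carrier_above by blast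
      then show "y \<in> f ` carrier (above P a)"
        using y a poset_isosD(2)[OF f] by (auto simp: carrier_above)
    qed
  qed (use f a in \<open>auto simp: carrier_above poset_isosD\<close>)
  moreover have "inj_on f (carrier (above P a))"
    using poset_isosD(1)[OF f] by (auto simp: carrier_above bij_betw_def inj_on_def)
  ultimately show ?thesis
    using poset_isosD(2)[OF f] unfolding poset_isos_def bij_betw_def leq_above
    by (auto simp: carrier_above)
qed

section \<open>Least elements\<close>

lemma least_elt_eqI:
  assumes "poset P" "z \<in> carrier P" "\<And>x. x \<in> carrier P \<Longrightarrow> (z, x) \<in> leq P"
  shows "least_elt P = z"
  unfolding least_elt_def using assms poset_antisym[OF assms(1)] by (intro the_equality) auto

text \<open>Some \<open>s\<close> exists, it is least in its own filter, and an isomorphism from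
  that filter onto \<open>P\<close> carries it to a least element of \<open>P\<close>.\<close>

lemma upho_least_elt:
  assumes "upho P"
  shows "least_elt P \<in> carrier P" "x \<in> carrier P \<Longrightarrow> (least_elt P, x) \<in> leq P"
proof -
  have P: "poset P" using assms by (simp add: upho_def)
  obtain s f where s: "s \<in> carrier P" and f: "f \<in> poset_isos (above P s) P"
    using assms unfolding upho_def by blast
  have s': "s \<in> carrier (above P s)"
    using s P by (simp add: carrier_above poset_refl)
  have "(f s, y) \<in> leq P" if "y \<in> carrier P" for y
  proof -
    obtain x where "x \<in> carrier (above P s)" "y = f x"
      using \<open>y \<in> carrier P\<close> poset_isos_surj[OF f] by blast
    then show ?thesis
      using s' poset_isosD(2)[OF f] by (auto simp: leq_above carrier_above)
  qed
  moreover have "f s \<in> carrier P" using poset_isosD(3)[OF f s'] .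
  ultimately have "least_elt P = f s" "f s \<in> carrier P" "\<And>y. y \<in> carrier P \<Longrightarrow> (f s, y) \<in> leq P"
    using least_elt_eqI[OF P] by auto
  then show "least_elt P \<in> carrier P" "x \<in> carrier P \<Longrightarrow> (least_elt P, x) \<in> leq P"
    by auto
qed

lemma poset_isos_least_elt:
  assumes f: "f \<in> poset_isos P Q" and "upho P" "poset Q"
  shows "f (least_elt P) = least_elt Q"
proof (rule least_elt_eqI[OF assms(3), symmetric])
  show "f (least_elt P) \<in> carrier Q"
    using poset_isosD(3)[OF f] upho_least_elt[OF assms(2)] by blast
  show "(f (least_elt P), y) \<in> leq Q" if "y \<in> carrier Q" for y
  proof -
    obtain x where "x \<in> carrier P" "y = f x"
      using \<open>y \<in> carrier Q\<close> poset_isos_surj[OF f] by blast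
    then show ?thesis
      using poset_isosD(2)[OF f] upho_least_elt[OF assms(2)] by blast
  qed
qed

section \<open>Saturated chains\<close>

lemma successively_imp_rtrancl:
  "successively (\<lambda>x y. (x, y) \<in> E) xs \<Longrightarrow> xs \<noteq> [] \<Longrightarrow> (hd xs, last xs) \<in> E\<^sup>*"
proof (induction xs rule: induct_list012)
  case (3 x y zs)
  then have "(y, last (y # zs)) \<in> E\<^sup>*" "(x, y) \<in> E" by auto
  then show ?case by (auto intro: converse_rtrancl_into_rtrancl)
qed auto

lemma rtrancl_imp_successively:
  assumes "(x, y) \<in> E\<^sup>*"
  shows "\<exists>xs. xs \<noteq> [] \<and> hd xs = x \<and> last xs = y \<and> successively (\<lambda>x y. (x, y) \<in> E) xs"
  using assms
proof (induction rule: converse_rtrancl_induct)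
  case base
  show ?case by (rule exI[of _ "[y]"]) simp
next
  case (step u v)
  then obtain xs where "xs \<noteq> []" "hd xs = v" "last xs = y" "successively (\<lambda>x y. (x, y) \<in> E) xs"
    by auto
  then show ?case using step.hyps(1)
    by (intro exI[of _ "u # xs"]) (auto simp: successively_Cons)
qed

text \<open>Puts saturated chains into a form that supports induction on the last edge.\<close>

lemma finitary_iff:
  "finitary P \<longleftrightarrow> (\<forall>s\<in>carrier P. (least_elt P, s) \<in> (edges P)\<^sup>*)"
proof -
  have "(\<exists>xs. xs \<noteq> [] \<and> hd xs = least_elt P \<and> last xs = s
      \<and> successively (\<lambda>x y. (x, y) \<in> edges P) xs) \<longleftrightarrow> (least_elt P, s) \<in> (edges P)\<^sup>*"
    (is "?L \<longleftrightarrow> ?R") for s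
  proof
    assume ?L
    then obtain xs where "xs \<noteq> []" "hd xs = least_elt P" "last xs = s"
      "successively (\<lambda>x y. (x, y) \<in> edges P) xs" by auto
    then show ?R using successively_imp_rtrancl[of "edges P" xs] by simp
  qed (rule rtrancl_imp_successively)
  then show ?thesis unfolding finitary_def by simp
qed

lemma poset_isos_edges_rtrancl:
  assumes f: "f \<in> poset_isos P Q" and "(x, y) \<in> (edges P)\<^sup>*"
  shows "(f x, f y) \<in> (edges Q)\<^sup>*"
  using assms(2)
proof (induction rule: rtrancl_induct)
  case (step u v)
  then have "(f u, f v) \<in> edges Q"
    using poset_isos_edges[OF f edges_carrier[OF step.hyps(2)]] by blast
  then show ?case using step.IH by (rule rtrancl_into_rtrancl[rotated])
qed simp

lemma finitary_poset_iso:
  assumes f: "f \<in> poset_isos P Q" and "upho P" "poset Q" "finitary P"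
  shows "finitary Q"
  unfolding finitary_iff
proof
  fix y assume "y \<in> carrier Q"
  then obtain x where x: "x \<in> carrier P" "y = f x"
    using poset_isos_surj[OF f] by blast
  then have "(least_elt P, x) \<in> (edges P)\<^sup>*"
    using assms(4) unfolding finitary_iff by blast
  then show "(least_elt Q, y) \<in> (edges Q)\<^sup>*"
    using poset_isos_edges_rtrancl[OF f] poset_isos_least_elt[OF f assms(2,3)] x(2) by metis
qed


section \<open>Gradings\<close>

text \<open>A grading constrains maximal chains only; this brings arbitrary chains under its
  control.\<close>

lemma chain_subset_maxchain:
  assumes X: "pred_on.chain A R X"
  shows "\<exists>C. pred_on.maxchain A R C \<and> X \<subseteq> C"
proof -
  define B where "B = {z \<in> A. \<forall>x\<in>X. R\<^sup>=\<^sup>= x z \<or> R\<^sup>=\<^sup>= z x}"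
  \<comment> \<open>A maximal chain among the elements comparable with all of \<open>X\<close> contains \<open>X\<close>.\<close>
  obtain C where C: "pred_on.maxchain B R C"
    using pred_on.Hausdorff[of B R] by blast
  then have CB: "C \<subseteq> B" and CC: "\<And>x y. x \<in> C \<Longrightarrow> y \<in> C \<Longrightarrow> R\<^sup>=\<^sup>= x y \<or> R\<^sup>=\<^sup>= y x"
    unfolding pred_on.maxchain_def pred_on.chain_def by simp_all
  have max: "\<not> C \<subset> S" if "pred_on.chain B R S" for S
    using C that unfolding pred_on.maxchain_def by simp
  have XA: "X \<subseteq> A" and XX: "\<And>x y. x \<in> X \<Longrightarrow> y \<in> X \<Longrightarrow> R\<^sup>=\<^sup>= x y \<or> R\<^sup>=\<^sup>= y x"
    using X unfolding pred_on.chain_def by simp_all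
  have XB: "R\<^sup>=\<^sup>= x z \<or> R\<^sup>=\<^sup>= z x" if "x \<in> X" "z \<in> B" for x z
    using that by (simp add: B_def)
  have "X \<subseteq> B" unfolding B_def using XA XX by blast
  \<comment> \<open>All of \<open>B\<close> is comparable with all of \<open>X\<close>, so adjoining
    \<open>X\<close> to \<open>C\<close> leaves a chain in \<open>B\<close>; maximality of
    \<open>C\<close> then forces \<open>X \<subseteq> C\<close>.\<close>
  have "pred_on.chain B R (X \<union> C)"
    unfolding pred_on.chain_def
  proof (intro conjI ballI)
    fix x y assume "x \<in> X \<union> C" "y \<in> X \<union> C"
    then consider "x \<in> X" "y \<in> B" | "y \<in> X" "x \<in> B" | "x \<in> C" "y \<in> C"
      using CB \<open>X \<subseteq> B\<close> by blast
    then show "R\<^sup>=\<^sup>= x y \<or> R\<^sup>=\<^sup>= y x"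
      using XB[of x y] XB[of y x] CC[of x y] by cases argo+
  qed (use CB \<open>X \<subseteq> B\<close> in simp)
  then have XC: "X \<subseteq> C"
    using max[of "X \<union> C"] by blast
  have "pred_on.maxchain A R C"
    unfolding pred_on.maxchain_def
  proof (intro conjI notI)
    show "pred_on.chain A R C"
      unfolding pred_on.chain_def using CB CC by (auto simp: B_def)
    assume "\<exists>S. pred_on.chain A R S \<and> C \<subset> S"
    then obtain S where S: "pred_on.chain A R S" "C \<subset> S" by blast
    then have "\<And>x y. x \<in> S \<Longrightarrow> y \<in> S \<Longrightarrow> R\<^sup>=\<^sup>= x y \<or> R\<^sup>=\<^sup>= y x" "S \<subseteq> A"
      unfolding pred_on.chain_def by simp_all
    \<comment> \<open>A chain containing \<open>C\<close> also contains \<open>X\<close>, so all its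
      elements are comparable with \<open>X\<close>. Maximality in \<open>B\<close> thus yields
      maximality in \<open>A\<close>.\<close>
    moreover from this have "S \<subseteq> B"
      using S(2) XC unfolding B_def by blast
    ultimately have "pred_on.chain B R S"
      unfolding pred_on.chain_def by simp
    with S(2) show False using max by blast
  qed
  with XC show ?thesis by blast
qed

section \<open>Ranks along saturated chains\<close>

lemma poset_chain_iff:
  assumes "poset P"
  shows "pred_on.chain (carrier P) (\<lambda>x y. (x, y) \<in> leq P) C \<longleftrightarrow>
    C \<subseteq> carrier P \<and> (\<forall>x\<in>C. \<forall>y\<in>C. (x, y) \<in> leq P \<or> (y, x) \<in> leq P)"
  using poset_refl[OF assms] by (fastforce simp: pred_on.chain_def)

text \<open>Extends \<open>X\<close> to a maximal chain and extracts the enumeration that the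
  grading provides. The index set is described only as downward closed, which treats finite and
  infinite maximal chains alike.\<close>

lemma grading_chain:
  assumes P: "upho P" and R: "is_grading P R"
    and X: "pred_on.chain (carrier P) (\<lambda>x y. (x, y) \<in> leq P) X"
  obtains p and I :: "nat set" where "X \<subseteq> p ` I" "0 \<in> I" "p 0 = least_elt P"
    "\<And>i j. j \<in> I \<Longrightarrow> i \<le> j \<Longrightarrow> i \<in> I \<and> (p i, p j) \<in> leq P"
    "\<And>i. i \<in> I \<Longrightarrow> p i \<in> R i" "\<And>i. Suc i \<in> I \<Longrightarrow> (p i, p (Suc i)) \<in> edges P"
proof -
  have pos: "poset P" using P by (simp add: upho_def)
  \<comment> \<open>Adjoining the least element fixes the start of the enumeration: it can only be
    \<open>p 0\<close>.\<close>
  have "pred_on.chain (carrier P) (\<lambda>x y. (x, y) \<in> leq P) (insert (least_elt P) X)"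
    using X upho_least_elt[OF P] poset_refl[OF pos] unfolding poset_chain_iff[OF pos]
    by (simp add: subset_iff)
  then obtain C where C: "pred_on.maxchain (carrier P) (\<lambda>x y. (x, y) \<in> leq P) C"
    and XC: "insert (least_elt P) X \<subseteq> C"
    using chain_subset_maxchain by blast
  obtain I p where I: "I = UNIV \<or> (\<exists>n. I = {..n})" and Cp: "C = p ` I"
    and pR: "\<forall>i\<in>I. p i \<in> R i" and pE: "\<forall>i. Suc i \<in> I \<longrightarrow> (p i, p (Suc i)) \<in> edges P"
    using R C unfolding is_grading_def by blast
  have sub: "C \<subseteq> carrier P"
    using C unfolding pred_on.maxchain_def pred_on.chain_def by blast
  have down: "i \<in> I" if "j \<in> I" "i \<le> j" for i j
    using I that by auto
  have mono: "(p i, p j) \<in> leq P" if "j \<in> I" "i \<le> j" for i j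
    using that(2,1)
  proof (induction j rule: dec_induct)
    case base
    then show ?case using sub Cp pos by (auto intro: poset_refl)
  next
    case (step j)
    then have "(p i, p j) \<in> leq P" "(p j, p (Suc j)) \<in> leq P"
      using down[of "Suc j" j] pE edges_leq[of "p j" "p (Suc j)" P] by simp_all
    then show ?case by (rule poset_trans[OF pos])
  qed
  obtain j where j: "j \<in> I" "p j = least_elt P" using XC Cp by auto
  have "p 0 = least_elt P"
    using mono[OF j(1), of 0] j down[OF j(1), of 0] sub Cp
    by (intro poset_antisym[OF pos]) (auto intro: upho_least_elt[OF P])
  moreover have "0 \<in> I" using down[OF j(1)] by simp
  ultimately show thesis
    using down mono pR pE XC Cp by (intro that[of p I]) auto
qed

text \<open>A maximal chain through \<open>f 0\<close>, ..., \<open>f n\<close> has nothing between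
  consecutive \<open>f i\<close>, as these are covers. Its enumeration \<open>p\<close> therefore
  begins with \<open>f\<close>, and \<open>f n\<close> has rank \<open>n\<close>.\<close>

lemma grading_relpow:
  assumes P: "upho P" and R: "is_grading P R" and x: "(least_elt P, x) \<in> edges P ^^ n"
  shows "x \<in> R n"
proof -
  have pos: "poset P" using P by (simp add: upho_def)
  obtain f where f0: "f 0 = least_elt P" and fn: "f n = x"
    and fE: "\<And>i. i < n \<Longrightarrow> (f i, f (Suc i)) \<in> edges P"
    using x by (auto simp: relpow_fun_conv)
  have fc: "f i \<in> carrier P" if "i \<le> n" for i
    using that f0 upho_least_elt(1)[OF P] edges_carrier(2)[OF fE[of "i - 1"]] by (cases i) auto
  have mono: "(f i, f j) \<in> leq P" if "i \<le> j" "j \<le> n" for i j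
    using that
  proof (induction j rule: dec_induct)
    case (step j)
    then show ?case using edges_leq[OF fE] by (auto intro: poset_trans[OF pos])
  qed (use fc pos in \<open>auto intro: poset_refl\<close>)
  have "pred_on.chain (carrier P) (\<lambda>x y. (x, y) \<in> leq P) (f ` {..n})"
    unfolding poset_chain_iff[OF pos]
  proof (intro conjI ballI)
    fix x y assume "x \<in> f ` {..n}" "y \<in> f ` {..n}"
    then obtain i j where "x = f i" "y = f j" "i \<le> n" "j \<le> n" by auto
    then show "(x, y) \<in> leq P \<or> (y, x) \<in> leq P"
      using mono[of i j] mono[of j i] linear[of i j] by blast
  qed (use fc in auto)
  then obtain p I where X: "f ` {..n} \<subseteq> p ` I" and I0: "(0::nat) \<in> I" and p0: "p 0 = least_elt P"
    and down: "\<And>i j. j \<in> I \<Longrightarrow> i \<le> j \<Longrightarrow> i \<in> I \<and> (p i, p j) \<in> leq P"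
    and pR: "\<And>i. i \<in> I \<Longrightarrow> p i \<in> R i" and pE: "\<And>i. Suc i \<in> I \<Longrightarrow> (p i, p (Suc i)) \<in> edges P"
    by (rule grading_chain[OF P R]) (rule that)
  have "i \<in> I \<and> f i = p i" if "i \<le> n" for i
    using that
  proof (induction i)
    case 0
    then show ?case using I0 f0 p0 by simp
  next
    case (Suc i)
    then have IH: "i \<in> I" "f i = p i" by auto
    have e: "(p i, f (Suc i)) \<in> edges P" using fE[of i] Suc.prems IH(2) by simp
    obtain j where j: "j \<in> I" "f (Suc i) = p j" using X Suc.prems by auto
    \<comment> \<open>\<open>f (Suc i)\<close> lies strictly above \<open>p i\<close>, so its index
      in the enumeration exceeds \<open>i\<close>.\<close>
    have "\<not> j \<le> i"
    proof
      assume "j \<le> i"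
      then have "(f (Suc i), p i) \<in> leq P" using down[OF IH(1)] j by auto
      then show False using edges_leq[OF e] edges_neq[OF e] poset_antisym[OF pos] by blast
    qed
    then have "Suc i \<in> I" "(p (Suc i), f (Suc i)) \<in> leq P" using down[OF j(1), of "Suc i"] j by auto
    moreover from this have "(p i, p (Suc i)) \<in> edges P" using pE by blast
    \<comment> \<open>\<open>p (Suc i)\<close> lies strictly above \<open>p i\<close> and at most at
      \<open>f (Suc i)\<close>, which covers \<open>p i\<close>.\<close>
    ultimately have "p (Suc i) = f (Suc i)"
      using edges_between[OF e, of "p (Suc i)"] edges_leq edges_neq edges_carrier by metis
    then show ?case using \<open>Suc i \<in> I\<close> by simp
  qed
  then show ?thesis using pR fn by auto
qed

text \<open>A maximal chain through \<open>s\<close> starts at the least element and proceeds by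
  covers, so it reaches \<open>s = p i\<close> after \<open>i\<close> edges.\<close>

lemma N_graded_imp_finitary:
  assumes P: "upho P" and "N_graded P"
  shows "finitary P"
  unfolding finitary_iff
proof
  fix s assume s: "s \<in> carrier P"
  obtain R where R: "is_grading P R" using assms(2) by (auto simp: N_graded_def)
  have "pred_on.chain (carrier P) (\<lambda>x y. (x, y) \<in> leq P) {s}"
    using s by (simp add: pred_on.chain_def)
  then obtain p I where X: "{s} \<subseteq> p ` I" and "0 \<in> I" and p0: "p (0::nat) = least_elt P"
    and down: "\<And>i j. j \<in> I \<Longrightarrow> i \<le> j \<Longrightarrow> i \<in> I \<and> (p i, p j) \<in> leq P"
    and "\<And>i. i \<in> I \<Longrightarrow> p i \<in> R i"
    and pE: "\<And>i. Suc i \<in> I \<Longrightarrow> (p i, p (Suc i)) \<in> edges P"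
    by (rule grading_chain[OF P R]) (rule that)
  have "(p 0, p i) \<in> (edges P)\<^sup>*" if "i \<in> I" for i
    using that
  proof (induction i)
    case (Suc i)
    then have "i \<in> I" "(p i, p (Suc i)) \<in> edges P" using down[of "Suc i" i] pE by auto
    then show ?case using Suc.IH by (auto intro: rtrancl_into_rtrancl)
  qed simp
  then show "(least_elt P, s) \<in> (edges P)\<^sup>*" using X p0 by auto
qed

section \<open>The monoid of a colored upho poset\<close>

lemma shift_isosD:
  assumes "\<phi> \<in> shift_isos P s"
  shows "\<phi> \<in> poset_isos (above P s) P"
    and "(u, v) \<in> edges (above P s) \<Longrightarrow> col P (\<phi> u) (\<phi> v) = col P u v"
  using assms by (auto simp: shift_isos_def)

lemma shift_isosI:
  assumes "\<phi> \<in> poset_isos (above P s) P"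
    and "\<And>u v. (u, v) \<in> edges (above P s) \<Longrightarrow> col P (\<phi> u) (\<phi> v) = col P u v"
  shows "\<phi> \<in> shift_isos P s"
  using assms by (auto simp: shift_isos_def)

text \<open>In a monoid the natural map, left multiplication, runs from the poset to the filter;
  this turns such a map around.\<close>

lemma shift_isos_invI:
  assumes f: "f \<in> poset_isos P (above P s)"
    and c: "\<And>u v. (u, v) \<in> edges P \<Longrightarrow> col P (f u) (f v) = col P u v"
  shows "inv_into (carrier P) f \<in> shift_isos P s"
proof (rule shift_isosI)
  let ?g = "inv_into (carrier P) f"
  show g: "?g \<in> poset_isos (above P s) P" using poset_isos_inv[OF f] .
  show "col P (?g u) (?g v) = col P u v" if uv: "(u, v) \<in> edges (above P s)" for u v
  proof -
    note uv' = edges_carrier[OF uv]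
    have "(?g u, ?g v) \<in> edges P" using poset_isos_edges[OF g uv'] uv by simp
    then have "col P (f (?g u)) (f (?g v)) = col P (?g u) (?g v)" by (rule c)
    then show ?thesis
      using bij_betw_inv_into_right[OF poset_isosD(1)[OF f]] uv' by simp
  qed
qed

lemma carrier_monoid_of [simp]: "carrier (monoid_of P) = carrier P"
  by (simp add: monoid_of_def)

lemma one_monoid_of [simp]: "\<one>\<^bsub>monoid_of P\<^esub> = least_elt P"
  by (simp add: monoid_of_def)

locale finitary_colored_upho =
  fixes P :: "'a colored_poset"
  assumes colored_upho: "colored_upho P" and finitary: "finitary P"
begin

abbreviation mul :: "'a \<Rightarrow> 'a \<Rightarrow> 'a" (infixl "\<cdot>" 70) where
  "s \<cdot> t \<equiv> s \<otimes>\<^bsub>monoid_of P\<^esub> t"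

abbreviation bottom :: 'a ("\<bottom>") where
  "\<bottom> \<equiv> least_elt P"

lemma upho: "upho P"
  using colored_upho by (simp add: colored_upho_def)

lemma poset: "poset P"
  using upho by (simp add: upho_def)

lemma bottom_carrier: "\<bottom> \<in> carrier P"
  by (rule upho_least_elt(1)[OF upho])

lemma bottom_leq: "x \<in> carrier P \<Longrightarrow> (\<bottom>, x) \<in> leq P"
  by (rule upho_least_elt(2)[OF upho])

lemma col_atom: "(u, v) \<in> edges P \<Longrightarrow> col P u v \<in> atoms P"
  using colored_upho by (auto simp: colored_upho_def)

lemma col_bottom: "t \<in> atoms P \<Longrightarrow> col P \<bottom> t = t"
  using colored_upho by (auto simp: colored_upho_def)

lemma above_self: "s \<in> carrier P \<Longrightarrow> s \<in> carrier (above P s)"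
  by (simp add: carrier_above poset_refl[OF poset])

lemma shift_isos_ex:
  assumes "s \<in> carrier P"
  obtains \<phi> where "\<phi> \<in> shift_isos P s"
  using assms colored_upho unfolding colored_upho_def by blast

lemma shift_isos_self:
  assumes \<phi>: "\<phi> \<in> shift_isos P s" and s: "s \<in> carrier P"
  shows "\<phi> s = \<bottom>"
proof (rule least_elt_eqI[OF poset, symmetric])
  note f = shift_isosD(1)[OF \<phi>]
  show "\<phi> s \<in> carrier P" using poset_isosD(3)[OF f above_self[OF s]] .
  show "(\<phi> s, y) \<in> leq P" if y: "y \<in> carrier P" for y
  proof -
    obtain x where x: "x \<in> carrier (above P s)" "y = \<phi> x"
      using poset_isos_surj[OF f y] .
    then show ?thesis
      using above_self[OF s] poset_isosD(2)[OF f, of s x] by (simp add: leq_above carrier_above)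
  qed
qed

lemma shift_isos_cover:
  assumes \<phi>: "\<phi> \<in> shift_isos P u" and uv: "(u, v) \<in> edges P"
  shows "\<phi> v = col P u v"
proof -
  have u: "u \<in> carrier P" and V: "u \<in> carrier (above P u)" "v \<in> carrier (above P u)"
    using edges_carrier[OF uv] edges_leq[OF uv] poset_refl[OF poset] by (simp_all add: carrier_above)
  have e: "(u, v) \<in> edges (above P u)" using uv V by (simp add: edges_above[OF poset])
  then have "(\<bottom>, \<phi> v) \<in> edges P"
    using poset_isos_edges[OF shift_isosD(1)[OF \<phi>] V] shift_isos_self[OF \<phi> u] by simp
  then have "col P \<bottom> (\<phi> v) = \<phi> v" by (intro col_bottom) (simp add: atoms_def)
  then show ?thesis using shift_isosD(2)[OF \<phi> e] shift_isos_self[OF \<phi> u] by simp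
qed

text \<open>A shift isomorphism at \<open>u\<close> is injective and sends both \<open>v\<close> and
  \<open>w\<close> to their colors. Hence a saturated chain is determined by its start and its
  sequence of colors.\<close>

lemma col_inj:
  assumes "(u, v) \<in> edges P" "(u, w) \<in> edges P" "col P u v = col P u w"
  shows "v = w"
proof -
  obtain \<phi> where \<phi>: "\<phi> \<in> shift_isos P u" using shift_isos_ex edges_carrier(1)[OF assms(1)] .
  have "v \<in> carrier (above P u)" "w \<in> carrier (above P u)"
    using edges_carrier(2)[OF assms(1)] edges_leq[OF assms(1)]
      edges_carrier(2)[OF assms(2)] edges_leq[OF assms(2)] by (simp_all add: carrier_above)
  then show ?thesis
    using shift_isos_cover[OF \<phi> assms(1)] shift_isos_cover[OF \<phi> assms(2)] assms(3)
      inj_onD[OF bij_betw_imp_inj_on[OF poset_isosD(1)[OF shift_isosD(1)[OF \<phi>]]], of v w] by simp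
qed

text \<open>Stated for inverses because finitariness supplies chains in \<open>P\<close> from the
  least element. Both inverses begin at \<open>s\<close> and preserve edges and colors, so
  \<open>col_inj\<close> keeps them equal along each edge.\<close>

lemma shift_isos_inv_unique:
  assumes \<phi>: "\<phi> \<in> shift_isos P s" and \<psi>: "\<psi> \<in> shift_isos P s" and s: "s \<in> carrier P"
    and x: "x \<in> carrier P"
  shows "inv_into (carrier (above P s)) \<phi> x = inv_into (carrier (above P s)) \<psi> x"
proof -
  let ?V = "carrier (above P s)"
  let ?f = "\<lambda>\<phi>. inv_into ?V \<phi>"
  have inv: "?f \<chi> \<bottom> = s"
    "(u, v) \<in> edges P \<Longrightarrow> (?f \<chi> u, ?f \<chi> v) \<in> edges P \<and> col P (?f \<chi> u) (?f \<chi> v) = col P u v"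
    if \<chi>: "\<chi> \<in> shift_isos P s" for \<chi> u v
  proof -
    note b = poset_isosD(1)[OF shift_isosD(1)[OF \<chi>]]
    show "?f \<chi> \<bottom> = s"
      using bij_betw_inv_into_left[OF b above_self[OF s]] shift_isos_self[OF \<chi> s] by simp
    assume uv: "(u, v) \<in> edges P"
    then have e: "(?f \<chi> u, ?f \<chi> v) \<in> edges (above P s)"
      using poset_isos_edges[OF poset_isos_inv[OF shift_isosD(1)[OF \<chi>]]] edges_carrier[OF uv] by simp
    moreover have "\<chi> (?f \<chi> u) = u" "\<chi> (?f \<chi> v) = v"
      using bij_betw_inv_into_right[OF b] edges_carrier[OF uv] by simp_all
    ultimately show "(?f \<chi> u, ?f \<chi> v) \<in> edges P \<and> col P (?f \<chi> u) (?f \<chi> v) = col P u v"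
      using shift_isosD(2)[OF \<chi> e] by (simp add: edges_above[OF poset])
  qed
  have "(\<bottom>, x) \<in> (edges P)\<^sup>*" using x finitary by (simp add: finitary_iff)
  then show ?thesis
  proof (induction rule: rtrancl_induct)
    case base
    then show ?case using inv(1)[OF \<phi>] inv(1)[OF \<psi>] by simp
  next
    case (step u v)
    then show ?case
      using inv(2)[OF \<phi> step.hyps(2)] inv(2)[OF \<psi> step.hyps(2)] col_inj by metis
  qed
qed

lemma shift_isos_unique:
  assumes \<phi>: "\<phi> \<in> shift_isos P s" and \<psi>: "\<psi> \<in> shift_isos P s" and s: "s \<in> carrier P"
    and v: "v \<in> carrier (above P s)"
  shows "\<phi> v = \<psi> v"
proof -
  note b = poset_isosD(1)[OF shift_isosD(1)[OF \<phi>]] poset_isosD(1)[OF shift_isosD(1)[OF \<psi>]]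
  have "\<psi> v \<in> carrier P" using b(2) v by (rule bij_betw_apply)
  moreover from this have "inv_into (carrier (above P s)) \<phi> (\<psi> v) = v"
    using shift_isos_inv_unique[OF \<phi> \<psi> s] bij_betw_inv_into_left[OF b(2) v] by simp
  ultimately show ?thesis using bij_betw_inv_into_right[OF b(1)] by metis
qed

lemma shift_iso:
  assumes s: "s \<in> carrier P"
  shows "shift_iso P s \<in> shift_isos P s"
proof -
  let ?V = "carrier (above P s)"
  obtain \<phi> where \<phi>: "\<phi> \<in> shift_isos P s" using shift_isos_ex[OF s] .
  \<comment> \<open>Membership in \<open>shift_isos\<close> depends only on values on the filter, so
    the restriction is an extensional witness for the definite description.\<close>
  define \<psi> where "\<psi> = restrict \<phi> ?V"
  have ext: "\<psi> x = \<phi> x" if "x \<in> ?V" for x using that by (simp add: \<psi>_def)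
  have "\<psi> \<in> poset_isos (above P s) P"
    using shift_isosD(1)[OF \<phi>] bij_betw_cong[of ?V \<psi> \<phi>] ext by (simp add: poset_isos_def)
  then have \<psi>: "\<psi> \<in> shift_isos P s"
    using shift_isosD(2)[OF \<phi>] ext edges_carrier[of _ _ "above P s"]
    by (intro shift_isosI) simp_all
  have "\<exists>!\<chi>. \<chi> \<in> shift_isos P s \<and> \<chi> \<in> extensional ?V"
  proof (rule ex1I[of _ \<psi>])
    show "\<chi> = \<psi>" if "\<chi> \<in> shift_isos P s \<and> \<chi> \<in> extensional ?V" for \<chi>
      using that shift_isos_unique[OF _ \<psi> s]
      by (intro extensionalityI[of _ ?V]) (auto simp: \<psi>_def)
  qed (simp add: \<psi>, simp add: \<psi>_def)
  from theI'[OF this] show ?thesis by (simp add: shift_iso_def)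
qed

text \<open>Any shift isomorphism at \<open>s\<close> computes products with \<open>s\<close>, so
  later proofs may supply whichever one is convenient.\<close>

lemma mult_shift_isos:
  assumes \<phi>: "\<phi> \<in> shift_isos P s" and s: "s \<in> carrier P" and t: "t \<in> carrier P"
  shows "s \<cdot> t \<in> carrier (above P s)" "\<phi> (s \<cdot> t) = t"
proof -
  note b = poset_isosD(1)[OF shift_isosD(1)[OF \<phi>]]
  have "s \<cdot> t = inv_into (carrier (above P s)) \<phi> t"
    using shift_isos_inv_unique[OF shift_iso[OF s] \<phi> s t] by (simp add: monoid_of_def)
  then show "s \<cdot> t \<in> carrier (above P s)" "\<phi> (s \<cdot> t) = t"
    using bij_betw_apply[OF bij_betw_inv_into[OF b] t] bij_betw_inv_into_right[OF b t] by simp_all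
qed

lemma mult_shift_isos_eq:
  assumes \<phi>: "\<phi> \<in> shift_isos P s" and s: "s \<in> carrier P" and v: "v \<in> carrier (above P s)"
  shows "s \<cdot> \<phi> v = v"
proof -
  note b = poset_isosD(1)[OF shift_isosD(1)[OF \<phi>]]
  have "\<phi> v \<in> carrier P" using b v by (rule bij_betw_apply)
  from mult_shift_isos[OF \<phi> s this] show ?thesis
    using inj_onD[OF bij_betw_imp_inj_on[OF b]] v by blast
qed

lemma mult_closed: "s \<in> carrier P \<Longrightarrow> t \<in> carrier P \<Longrightarrow> s \<cdot> t \<in> carrier P"
  using mult_shift_isos(1)[OF shift_iso] by (simp add: carrier_above)

text \<open>\<open>\<phi>\<close> carries the filter of \<open>a\<close> onto that of
  \<open>t\<close>, which \<open>\<psi>\<close> carries onto \<open>P\<close>. With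
  \<open>a = s \<cdot> t\<close> this is the composition law behind associativity.\<close>

lemma shift_isos_comp:
  assumes \<phi>: "\<phi> \<in> shift_isos P s" and \<psi>: "\<psi> \<in> shift_isos P t" and t: "t \<in> carrier P"
    and a: "a \<in> carrier (above P s)" "\<phi> a = t"
  shows "\<psi> \<circ> \<phi> \<in> shift_isos P a"
proof (rule shift_isosI)
  have sa: "(s, a) \<in> leq P" using a(1) by (simp add: carrier_above)
  have f: "\<phi> \<in> poset_isos (above P a) (above P t)"
    using poset_isos_above[OF shift_isosD(1)[OF \<phi>] a(1)] a(2) above_above[OF poset sa] by simp
  then show "\<psi> \<circ> \<phi> \<in> poset_isos (above P a) P"
    using shift_isosD(1)[OF \<psi>] by (rule poset_isos_comp)
  show "col P ((\<psi> \<circ> \<phi>) u) ((\<psi> \<circ> \<phi>) v) = col P u v" if uv: "(u, v) \<in> edges (above P a)" for u v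
  proof -
    have "(\<phi> u, \<phi> v) \<in> edges (above P t)"
      using poset_isos_edges[OF f edges_carrier[OF uv]] uv by simp
    moreover have "(u, v) \<in> edges (above P s)"
      using uv unfolding edges_above[OF poset] carrier_above
      by (auto intro: poset_trans[OF poset sa])
    ultimately show ?thesis using shift_isosD(2)[OF \<phi>] shift_isosD(2)[OF \<psi>] by simp
  qed
qed

lemma mult_assoc:
  assumes s: "s \<in> carrier P" and t: "t \<in> carrier P" and u: "u \<in> carrier P"
  shows "(s \<cdot> t) \<cdot> u = s \<cdot> (t \<cdot> u)"
proof -
  obtain \<phi> where \<phi>: "\<phi> \<in> shift_isos P s" using shift_isos_ex[OF s] .
  obtain \<psi> where \<psi>: "\<psi> \<in> shift_isos P t" using shift_isos_ex[OF t] .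
  note st = mult_shift_isos[OF \<phi> s t] and tu = mult_shift_isos[OF \<psi> t u]
    and w = mult_shift_isos[OF \<phi> s mult_closed[OF t u]]
  \<comment> \<open>The relation between \<open>t\<close> and \<open>t \<cdot> u\<close> is pulled
    back along \<open>\<phi>\<close>.\<close>
  have "(s \<cdot> t, s \<cdot> (t \<cdot> u)) \<in> leq (above P s)"
    using poset_isosD(2)[OF shift_isosD(1)[OF \<phi>] st(1) w(1)] st(2) w(2) tu(1)
    by (simp add: carrier_above)
  then have "s \<cdot> (t \<cdot> u) \<in> carrier (above P (s \<cdot> t))"
    by (simp add: leq_above carrier_above)
  \<comment> \<open>\<open>\<phi>\<close> sends \<open>s \<cdot> (t \<cdot> u)\<close> to
    \<open>t \<cdot> u\<close>, and \<open>\<psi>\<close> sends that to \<open>u\<close>.\<close>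
  then have "(s \<cdot> t) \<cdot> (\<psi> \<circ> \<phi>) (s \<cdot> (t \<cdot> u)) = s \<cdot> (t \<cdot> u)"
    by (rule mult_shift_isos_eq[OF shift_isos_comp[OF \<phi> \<psi> t st] mult_closed[OF s t]])
  then show ?thesis using w(2) tu(2) by simp
qed

text \<open>The filter of the least element is all of \<open>P\<close>, and the identity is a shift
  isomorphism there.\<close>

lemma bottom_mult: "t \<in> carrier P \<Longrightarrow> \<bottom> \<cdot> t = t"
proof -
  assume t: "t \<in> carrier P"
  have V: "carrier (above P \<bottom>) = carrier P" using bottom_leq by (auto simp: carrier_above)
  have "leq (above P \<bottom>) = leq P"
    unfolding leq_above V using poset_leq_carrier[OF poset] by auto
  with V have "(\<lambda>x. x) \<in> poset_isos (above P \<bottom>) P"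
    by (simp add: poset_isos_def bij_betw_def)
  then have "(\<lambda>x. x) \<in> shift_isos P \<bottom>" by (intro shift_isosI) simp_all
  from mult_shift_isos(2)[OF this bottom_carrier t] show ?thesis .
qed

lemma mult_bottom: "s \<in> carrier P \<Longrightarrow> s \<cdot> \<bottom> = s"
  using mult_shift_isos_eq[OF shift_iso _ above_self] shift_isos_self[OF shift_iso] by metis

section \<open>Monoid properties and divisibility\<close>

lemma monoid: "monoid (monoid_of P)"
  by (rule monoidI)
    (simp_all add: mult_closed mult_assoc bottom_carrier bottom_mult mult_bottom)

lemma left_cancellative: "left_cancellative (monoid_of P)"
  unfolding left_cancellative_def carrier_monoid_of using mult_shift_isos(2)[OF shift_iso] by metis

text \<open>Each \<open>s\<close> lies below its multiple \<open>s \<cdot> t\<close>; if the latter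
  is the least element, so is \<open>s\<close>, and then \<open>t\<close> equals the
  product.\<close>

lemma invertible_free: "invertible_free (monoid_of P)"
  unfolding invertible_free_def carrier_monoid_of one_monoid_of
proof (intro ballI impI)
  fix s t assume s: "s \<in> carrier P" and t: "t \<in> carrier P" and st: "s \<cdot> t = \<bottom>"
  have "(s, \<bottom>) \<in> leq P"
    using mult_shift_isos(1)[OF shift_iso[OF s] s t] st by (simp add: carrier_above)
  then have "s = \<bottom>" using bottom_leq[OF s] by (rule poset_antisym[OF poset])
  then show "s = \<bottom> \<and> t = \<bottom>" using st bottom_mult[OF t] by simp
qed

text \<open>The inverse of the shift isomorphism at \<open>s\<close> has the filter of
  \<open>s\<close> as its image. Hence divisibility recovers the order of \<open>P\<close>.\<close>

lemma leq_iff_mult: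
  assumes "s \<in> carrier P"
  shows "(s, v) \<in> leq P \<longleftrightarrow> (\<exists>t\<in>carrier P. s \<cdot> t = v)"
proof
  assume "(s, v) \<in> leq P"
  then have v: "v \<in> carrier (above P s)"
    using poset_leq_carrier[OF poset] by (simp add: carrier_above)
  show "\<exists>t\<in>carrier P. s \<cdot> t = v"
    using mult_shift_isos_eq[OF shift_iso[OF assms] assms v]
      poset_isosD(3)[OF shift_isosD(1)[OF shift_iso[OF assms]] v] by blast
next
  assume "\<exists>t\<in>carrier P. s \<cdot> t = v"
  then show "(s, v) \<in> leq P"
    using mult_shift_isos(1)[OF shift_iso[OF assms] assms] by (auto simp: carrier_above)
qed

text \<open>The shift isomorphism at \<open>u\<close> sends \<open>v\<close> to the color, which is
  therefore the cofactor that \<open>poset_of\<close> reads off as color.\<close>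

lemma mult_col: "(u, v) \<in> edges P \<Longrightarrow> u \<cdot> col P u v = v"
proof -
  assume uv: "(u, v) \<in> edges P"
  have u: "u \<in> carrier P" and v: "v \<in> carrier (above P u)"
    using edges_carrier[OF uv] edges_leq[OF uv] by (simp_all add: carrier_above)
  show "u \<cdot> col P u v = v"
    using mult_shift_isos_eq[OF shift_iso[OF u] u v] shift_isos_cover[OF shift_iso[OF u] uv] by simp
qed

text \<open>Colors are compared separately, since the two color functions may differ off the
  edges.\<close>

lemma poset_of_monoid_of:
  "carrier (poset_of (monoid_of P)) = carrier P" "leq (poset_of (monoid_of P)) = leq P"
proof -
  show "leq (poset_of (monoid_of P)) = leq P"
  proof (rule Set.set_eqI)
    fix e :: "'a \<times> 'a"
    obtain a b where e: "e = (a, b)" by fastforce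
    show "e \<in> leq (poset_of (monoid_of P)) \<longleftrightarrow> e \<in> leq P"
      using leq_iff_mult[of a b] poset_leq_carrier[OF poset, of a b]
      by (auto simp: poset_of_def e)
  qed
qed (simp add: poset_of_def)

end

section \<open>The colored poset of a monoid\<close>

lemma list_prod_Nil [simp]: "list_prod M [] = \<one>\<^bsub>M\<^esub>"
  by (simp add: list_prod_def)

lemma list_prod_Cons [simp]: "list_prod M (a # as) = a \<otimes>\<^bsub>M\<^esub> list_prod M as"
  by (simp add: list_prod_def)

lemma carrier_poset_of [simp]: "carrier (poset_of M) = carrier M"
  by (simp add: poset_of_def)

lemma leq_poset_of:
  "(a, b) \<in> leq (poset_of M) \<longleftrightarrow>
    a \<in> carrier M \<and> b \<in> carrier M \<and> (\<exists>c\<in>carrier M. a \<otimes>\<^bsub>M\<^esub> c = b)"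
  by (simp add: poset_of_def)

locale lcif_monoid = monoid M for M :: "'a monoid" (structure) +
  assumes left_cancellative: "left_cancellative M" and invertible_free: "invertible_free M"
begin

lemma irreducibles_carrier: "a \<in> irreducibles M \<Longrightarrow> a \<in> carrier M"
  by (simp add: irreducibles_def)

lemma left_cancel:
  "a \<in> carrier M \<Longrightarrow> x \<in> carrier M \<Longrightarrow> y \<in> carrier M \<Longrightarrow> a \<otimes> x = a \<otimes> y \<longleftrightarrow> x = y"
  using left_cancellative unfolding left_cancellative_def by metis

lemma mult_eq_left: "a \<in> carrier M \<Longrightarrow> x \<in> carrier M \<Longrightarrow> a \<otimes> x = a \<longleftrightarrow> x = \<one>"
  using left_cancel[of a x \<one>] by simp

lemma mult_eq_one: "x \<in> carrier M \<Longrightarrow> y \<in> carrier M \<Longrightarrow> x \<otimes> y = \<one> \<longleftrightarrow> x = \<one> \<and> y = \<one>"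
  using invertible_free unfolding invertible_free_def by (metis one_closed l_one)

lemma Units_eq: "Units M = {\<one>}"
  using mult_eq_one by (auto simp: Units_def)

lemma irreducible_iff:
  "a \<in> irreducibles M \<longleftrightarrow> a \<in> carrier M \<and> a \<noteq> \<one> \<and>
    (\<forall>b\<in>carrier M. \<forall>c\<in>carrier M. a = b \<otimes> c \<longrightarrow> b = \<one> \<or> c = \<one>)"
  by (auto simp: irreducibles_def Units_eq)

lemma list_prod_closed: "set as \<subseteq> carrier M \<Longrightarrow> list_prod M as \<in> carrier M"
  by (induction as) auto

lemma list_prod_irreducibles_closed: "set as \<subseteq> irreducibles M \<Longrightarrow> list_prod M as \<in> carrier M"
  using irreducibles_carrier by (intro list_prod_closed) auto

lemma poset_poset_of: "poset (poset_of M)"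
  unfolding poset_def order_on_defs
proof (intro conjI)
  show "leq (poset_of M) \<subseteq> carrier (poset_of M) \<times> carrier (poset_of M)"
    by (auto simp: leq_poset_of)
  show "refl_on (carrier (poset_of M)) (leq (poset_of M))"
    by (auto simp: refl_on_def leq_poset_of intro: bexI[of _ \<one>])
  show "trans (leq (poset_of M))"
  proof (rule transI)
    fix x y z assume "(x, y) \<in> leq (poset_of M)" "(y, z) \<in> leq (poset_of M)"
    then obtain c d where "x \<in> carrier M" "c \<in> carrier M" "d \<in> carrier M"
      "y = x \<otimes> c" "z = y \<otimes> d" by (auto simp: leq_poset_of)
    then show "(x, z) \<in> leq (poset_of M)"
      by (auto simp: leq_poset_of m_assoc intro!: bexI[of _ "c \<otimes> d"])
  qed
  show "antisym (leq (poset_of M))"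
  proof (rule antisymI)
    fix x y assume "(x, y) \<in> leq (poset_of M)" "(y, x) \<in> leq (poset_of M)"
    then obtain c d where x: "x \<in> carrier M" "c \<in> carrier M" "d \<in> carrier M"
      "y = x \<otimes> c" "x = y \<otimes> d" unfolding leq_poset_of by metis
    then have "x \<otimes> (c \<otimes> d) = x" using m_assoc by metis
    \<comment> \<open>Left cancellation gives \<open>c \<otimes> d = \<one>\<close>, and absence of
      nontrivial invertibles then makes \<open>c\<close> trivial.\<close>
    then have "c = \<one>" using x(1-3) by (simp add: mult_eq_left mult_eq_one)
    then show "x = y" using x(1,4) by simp
  qed
qed

lemma least_poset_of: "least_elt (poset_of M) = \<one>"
  by (rule least_elt_eqI[OF poset_poset_of]) (auto simp: leq_poset_of)

text \<open>With \<open>b = a \<otimes> c\<close>, left cancellation matches the elements between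
  \<open>a\<close> and \<open>b\<close> with the left factors of \<open>c\<close>. Nothing lies
  strictly between exactly when \<open>c\<close> has only trivial factorizations.\<close>

lemma edges_poset_of:
  "(a, b) \<in> edges (poset_of M) \<longleftrightarrow> a \<in> carrier M \<and> (\<exists>c\<in>irreducibles M. b = a \<otimes> c)"
proof (intro iffI conjI)
  assume e: "(a, b) \<in> edges (poset_of M)"
  then show a: "a \<in> carrier M" using edges_carrier by fastforce
  obtain c where c: "c \<in> carrier M" "b = a \<otimes> c"
    using edges_leq[OF e] by (auto simp: leq_poset_of)
  have "d = \<one> \<or> f = \<one>" if d: "d \<in> carrier M" "f \<in> carrier M" "c = d \<otimes> f" for d f
  proof -
    have "(a, a \<otimes> d) \<in> leq (poset_of M)" "(a \<otimes> d, b) \<in> leq (poset_of M)"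
      using a c d by (auto simp: leq_poset_of m_assoc)
    then have "a \<otimes> d = a \<or> a \<otimes> d = b"
      using edges_between[OF e, of "a \<otimes> d"] a d by simp
    then show ?thesis
      using a c d left_cancel[of a d "d \<otimes> f"] mult_eq_left[of d f] mult_eq_left[of a d] by metis
  qed
  moreover have "c \<noteq> \<one>" using edges_neq[OF e] a c by auto
  ultimately show "\<exists>c\<in>irreducibles M. b = a \<otimes> c"
    using c by (auto simp: irreducible_iff)
next
  assume "a \<in> carrier M \<and> (\<exists>c\<in>irreducibles M. b = a \<otimes> c)"
  then obtain c where a: "a \<in> carrier M" and c: "c \<in> irreducibles M" and b: "b = a \<otimes> c" by auto
  note c' = c[unfolded irreducible_iff]
  have "x = a \<or> x = b" if x: "(a, x) \<in> leq (poset_of M)" "(x, b) \<in> leq (poset_of M)" for x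
  proof -
    obtain d f where d: "d \<in> carrier M" "f \<in> carrier M" "x = a \<otimes> d" "b = x \<otimes> f"
      using x by (auto simp: leq_poset_of)
    then have "c = d \<otimes> f" using a b c' left_cancel[of a c "d \<otimes> f"] by (simp add: m_assoc)
    then have "d = \<one> \<or> f = \<one>" using c' d by blast
    then show ?thesis using a b d by auto
  qed
  moreover have "a \<noteq> b" using a b c' mult_eq_left[of a c] by auto
  ultimately show "(a, b) \<in> edges (poset_of M)"
    using a b c' by (simp add: edges_def) (metis leq_poset_of m_closed)
qed

lemma atoms_poset_of: "atoms (poset_of M) = irreducibles M"
proof -
  have "s \<in> atoms (poset_of M) \<longleftrightarrow> s \<in> irreducibles M" for s
    using irreducibles_carrier by (auto simp: atoms_def least_poset_of edges_poset_of)
  then show ?thesis by blast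
qed

lemma col_poset_of:
  assumes "a \<in> carrier M" "c \<in> irreducibles M"
  shows "col (poset_of M) a (a \<otimes> c) = c"
proof -
  have "(THE d. d \<in> irreducibles M \<and> a \<otimes> d = a \<otimes> c) = c"
    using assms left_cancel irreducibles_carrier by (intro the_equality) auto
  then show ?thesis by (simp add: poset_of_def)
qed

lemma mult_poset_isos:
  assumes s: "s \<in> carrier M"
  shows "(\<lambda>x. s \<otimes> x) \<in> poset_isos (poset_of M) (above (poset_of M) s)"
proof -
  have img: "(\<lambda>x. s \<otimes> x) ` carrier M = carrier (above (poset_of M) s)"
    using s by (auto simp: carrier_above leq_poset_of)
  have "inj_on (\<lambda>x. s \<otimes> x) (carrier M)"
    using s left_cancel by (auto simp: inj_on_def)
  moreover have "(s \<otimes> x, s \<otimes> y) \<in> leq (above (poset_of M) s) \<longleftrightarrow> (x, y) \<in> leq (poset_of M)"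
    if "x \<in> carrier M" "y \<in> carrier M" for x y
    using that s img by (auto simp: leq_above leq_poset_of m_assoc left_cancel)
  ultimately show ?thesis using img by (simp add: poset_isos_def bij_betw_def)
qed

text \<open>Left multiplication by \<open>s\<close> takes an edge with cofactor \<open>c\<close> to
  an edge with the same cofactor, so it preserves colors.\<close>

lemma inv_mult_shift_isos:
  assumes s: "s \<in> carrier M"
  shows "inv_into (carrier M) (\<lambda>x. s \<otimes> x) \<in> shift_isos (poset_of M) s"
proof -
  have "col (poset_of M) (s \<otimes> u) (s \<otimes> v) = col (poset_of M) u v"
    if "(u, v) \<in> edges (poset_of M)" for u v
  proof -
    obtain c where c: "u \<in> carrier M" "c \<in> irreducibles M" "v = u \<otimes> c"
      using \<open>(u, v) \<in> edges (poset_of M)\<close> by (auto simp: edges_poset_of)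
    then have "s \<otimes> v = (s \<otimes> u) \<otimes> c"
      using s irreducibles_carrier[OF c(2)] by (simp add: m_assoc)
    then show ?thesis using c s by (simp add: col_poset_of)
  qed
  from shift_isos_invI[OF mult_poset_isos[OF s] this] show ?thesis by simp
qed

lemma colored_upho_poset_of: "colored_upho (poset_of M)"
  unfolding colored_upho_def upho_def
proof (intro conjI ballI)
  show "poset (poset_of M)" by (rule poset_poset_of)
  show "carrier (poset_of M) \<noteq> {}" by auto
  fix s assume "s \<in> carrier (poset_of M)"
  then have s: "s \<in> carrier M" by simp
  show "shift_isos (poset_of M) s \<noteq> {}" using inv_mult_shift_isos[OF s] by blast
  show "poset_isos (above (poset_of M) s) (poset_of M) \<noteq> {}"
    using shift_isosD(1)[OF inv_mult_shift_isos[OF s]] by blast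
next
  fix e assume "e \<in> edges (poset_of M)"
  then show "case e of (r, s) \<Rightarrow> col (poset_of M) r s \<in> atoms (poset_of M)"
    by (cases e) (auto simp: edges_poset_of col_poset_of atoms_poset_of)
next
  fix t assume "t \<in> atoms (poset_of M)"
  then show "col (poset_of M) (least_elt (poset_of M)) t = t"
    using col_poset_of[of \<one> t] irreducibles_carrier[of t]
    by (simp add: atoms_poset_of least_poset_of)
qed

text \<open>Each edge multiplies by one irreducible on the right, so a chain of \<open>n\<close>
  edges spells a word of length \<open>n\<close>.\<close>

lemma relpow_edges_poset_of:
  assumes "a \<in> carrier M"
  shows "(a, b) \<in> edges (poset_of M) ^^ n \<longleftrightarrow>
    (\<exists>as. set as \<subseteq> irreducibles M \<and> length as = n \<and> b = a \<otimes> list_prod M as)"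
  using assms
proof (induction n arbitrary: a)
  case 0
  then show ?case by auto
next
  case (Suc n)
  \<comment> \<open>\<open>list_prod\<close> folds from the head of the list, so the first edge is
    split off; the defining equation of relational powers would split off the last.\<close>
  have "(a, b) \<in> edges (poset_of M) ^^ Suc n \<longleftrightarrow>
      (\<exists>x. (a, x) \<in> edges (poset_of M) \<and> (x, b) \<in> edges (poset_of M) ^^ n)"
    by (auto simp: relpow_commute simp del: relpow.simps(2) intro: relpow_Suc_I2 dest: relpow_Suc_D2)
  also have "\<dots> \<longleftrightarrow> (\<exists>c\<in>irreducibles M. (a \<otimes> c, b) \<in> edges (poset_of M) ^^ n)"
    using Suc.prems by (auto simp: edges_poset_of)
  also have "\<dots> \<longleftrightarrow> (\<exists>c\<in>irreducibles M. \<exists>as. set as \<subseteq> irreducibles M \<and> length as = n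
      \<and> b = (a \<otimes> c) \<otimes> list_prod M as)"
    using Suc.prems Suc.IH irreducibles_carrier by simp
  also have "\<dots> \<longleftrightarrow> (\<exists>c as. c \<in> irreducibles M \<and> set as \<subseteq> irreducibles M \<and> length as = n
      \<and> b = a \<otimes> (c \<otimes> list_prod M as))"
    using Suc.prems m_assoc irreducibles_carrier list_prod_irreducibles_closed
    by (metis (no_types, opaque_lifting))
  also have "\<dots> \<longleftrightarrow> (\<exists>as. set as \<subseteq> irreducibles M \<and> length as = Suc n \<and> b = a \<otimes> list_prod M as)"
    (is "?L \<longleftrightarrow> ?R")
  proof
    assume ?L
    then obtain c as where "c \<in> irreducibles M" "set as \<subseteq> irreducibles M" "length as = n"
      "b = a \<otimes> list_prod M (c # as)" by auto
    then show ?R by (intro exI[of _ "c # as"]) simp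
  qed (force simp: length_Suc_conv)
  finally show ?case .
qed

lemma relpow_edges_one:
  "(\<one>, b) \<in> edges (poset_of M) ^^ n \<longleftrightarrow>
    (\<exists>as. set as \<subseteq> irreducibles M \<and> length as = n \<and> b = list_prod M as)"
  using relpow_edges_poset_of[of \<one> b n] list_prod_irreducibles_closed by auto

lemma finitary_poset_of: "finitary (poset_of M) \<longleftrightarrow> atomic M"
  unfolding finitary_iff least_poset_of atomic_def rtrancl_power relpow_edges_one
  by (auto; metis)

text \<open>Turns uniqueness of factorization length into uniqueness of chain length, the form in
  which it meets gradings.\<close>

lemma homogeneous_iff:
  "homogeneous M \<longleftrightarrow> atomic M \<and> (\<forall>x m n. (\<one>, x) \<in> edges (poset_of M) ^^ m \<longrightarrow>
    (\<one>, x) \<in> edges (poset_of M) ^^ n \<longrightarrow> m = n)"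
  unfolding homogeneous_def relpow_edges_one by metis

end

section \<open>Mutual inverseness\<close>

text \<open>These notions ignore colors, so they transfer between
  \<open>poset_of (monoid_of P)\<close> and \<open>P\<close>.\<close>

lemma order_cong:
  fixes P Q :: "'a colored_poset"
  assumes "carrier P = carrier Q" "leq P = leq Q"
  shows "edges P = edges Q" "finitary P = finitary Q" "N_graded P = N_graded Q"
    "finite_type_N_graded P = finite_type_N_graded Q"
proof -
  show e: "edges P = edges Q" by (simp add: edges_def assms)
  have "least_elt P = least_elt Q" by (simp add: least_elt_def assms)
  then show "finitary P = finitary Q" by (simp add: finitary_def assms e)
  have g: "is_grading P R = is_grading Q R" for R by (simp add: is_grading_def assms e)
  show "N_graded P = N_graded Q" "finite_type_N_graded P = finite_type_N_graded Q"
    by (simp_all add: N_graded_def finite_type_N_graded_def g)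
qed

context finitary_colored_upho
begin

lemma lcif_monoid: "lcif_monoid (monoid_of P)"
  by (intro lcif_monoid.intro lcif_monoid_axioms.intro monoid left_cancellative invertible_free)

lemmas poset_of_monoid_of_cong = order_cong[OF poset_of_monoid_of]

text \<open>\<open>poset_of (monoid_of P)\<close> has the order of \<open>P\<close>, so it is
  finitary, which for the poset of a monoid means atomicity.\<close>

lemma atomic: "atomic (monoid_of P)"
  using lcif_monoid.finitary_poset_of[OF lcif_monoid] finitary poset_of_monoid_of_cong(2) by simp

lemma atoms_irreducibles: "atoms P = irreducibles (monoid_of P)"
  using lcif_monoid.atoms_poset_of[OF lcif_monoid] lcif_monoid.least_poset_of[OF lcif_monoid]
  by (simp add: atoms_def poset_of_monoid_of_cong(1))

lemma col_poset_of_monoid_of: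
  assumes "(u, v) \<in> edges P"
  shows "col (poset_of (monoid_of P)) u v = col P u v"
  using lcif_monoid.col_poset_of[OF lcif_monoid, of u "col P u v"] mult_col[OF assms]
    edges_carrier(1)[OF assms] col_atom[OF assms] by (simp add: atoms_irreducibles)

lemma poset_of_monoid_of_iso: "(\<lambda>x. x) \<in> colored_isos (poset_of (monoid_of P)) P"
  using col_poset_of_monoid_of
  by (auto simp: colored_isos_def poset_isos_def bij_betw_def
      poset_of_monoid_of(2) poset_of_monoid_of_cong(1))

end

lemma (in lcif_monoid) finitary_colored_upho_poset_of:
  "atomic M \<Longrightarrow> finitary_colored_upho (poset_of M)"
  using colored_upho_poset_of finitary_poset_of by (intro finitary_colored_upho.intro) simp_all

text \<open>The inverse of left multiplication is a shift isomorphism, so both multiplications agree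
  on the carrier. They may differ outside it, hence an isomorphism instead of an equality.\<close>

lemma (in lcif_monoid) monoid_of_poset_of_iso:
  assumes "atomic M"
  shows "(\<lambda>x. x) \<in> iso (monoid_of (poset_of M)) M"
proof -
  interpret Q: finitary_colored_upho "poset_of M"
    using finitary_colored_upho_poset_of[OF assms] .
  have "s \<otimes>\<^bsub>monoid_of (poset_of M)\<^esub> t = s \<otimes> t" if s: "s \<in> carrier M" and t: "t \<in> carrier M" for s t
  proof -
    have "inj_on ((\<otimes>) s) (carrier M)" using s left_cancel by (auto simp: inj_on_def)
    then have "inv_into (carrier M) ((\<otimes>) s) (s \<otimes> t) = t" using t by simp
    moreover have "s \<otimes> t \<in> carrier (above (poset_of M) s)"
      using s t by (auto simp: carrier_above leq_poset_of)
    ultimately show ?thesis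
      using Q.mult_shift_isos_eq[OF inv_mult_shift_isos[OF s], of "s \<otimes> t"] s by simp
  qed
  then show ?thesis by (auto simp: iso_def hom_def bij_betw_def)
qed


section \<open>Isomorphisms\<close>

lemma colored_isosD:
  assumes "\<sigma> \<in> colored_isos P Q"
  shows "\<sigma> \<in> poset_isos P Q" "(u, v) \<in> edges P \<Longrightarrow> col Q (\<sigma> u) (\<sigma> v) = \<sigma> (col P u v)"
  using assms by (auto simp: colored_isos_def)

lemma colored_isosI:
  assumes "\<sigma> \<in> poset_isos P Q" "\<And>u v. (u, v) \<in> edges P \<Longrightarrow> col Q (\<sigma> u) (\<sigma> v) = \<sigma> (col P u v)"
  shows "\<sigma> \<in> colored_isos P Q"
  using assms by (auto simp: colored_isos_def)

text \<open>The inverse of a colored isomorphism undoes it only on the carrier, so colors must be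
  known to lie there.\<close>

lemma col_carrier:
  assumes "colored_upho P" "(u, v) \<in> edges P"
  shows "col P u v \<in> carrier P"
proof -
  have "col P u v \<in> atoms P" using assms by (auto simp: colored_upho_def)
  then have "(least_elt P, col P u v) \<in> edges P" by (simp add: atoms_def)
  then show ?thesis by (rule edges_carrier(2))
qed

lemma colored_isos_refl: "(\<lambda>x. x) \<in> colored_isos P P"
  by (simp add: colored_isos_def poset_isos_def bij_betw_def)

lemma colored_isos_comp:
  assumes \<sigma>: "\<sigma> \<in> colored_isos P Q" and \<tau>: "\<tau> \<in> colored_isos Q R"
  shows "\<tau> \<circ> \<sigma> \<in> colored_isos P R"
proof (rule colored_isosI)
  show "\<tau> \<circ> \<sigma> \<in> poset_isos P R"
    using colored_isosD(1)[OF \<sigma>] colored_isosD(1)[OF \<tau>] by (rule poset_isos_comp)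
  show "col R ((\<tau> \<circ> \<sigma>) u) ((\<tau> \<circ> \<sigma>) v) = (\<tau> \<circ> \<sigma>) (col P u v)" if uv: "(u, v) \<in> edges P" for u v
  proof -
    have "(\<sigma> u, \<sigma> v) \<in> edges Q"
      using poset_isos_edges[OF colored_isosD(1)[OF \<sigma>] edges_carrier[OF uv]] uv by simp
    then show ?thesis using colored_isosD(2)[OF \<sigma> uv] colored_isosD(2)[OF \<tau>] by simp
  qed
qed

lemma colored_isos_inv:
  assumes \<sigma>: "\<sigma> \<in> colored_isos P Q" and P: "colored_upho P"
  shows "inv_into (carrier P) \<sigma> \<in> colored_isos Q P"
proof (rule colored_isosI)
  let ?\<tau> = "inv_into (carrier P) \<sigma>"
  note b = poset_isosD(1)[OF colored_isosD(1)[OF \<sigma>]]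
  show \<tau>: "?\<tau> \<in> poset_isos Q P" using poset_isos_inv[OF colored_isosD(1)[OF \<sigma>]] .
  show "col P (?\<tau> u) (?\<tau> v) = ?\<tau> (col Q u v)" if uv: "(u, v) \<in> edges Q" for u v
  proof -
    have e: "(?\<tau> u, ?\<tau> v) \<in> edges P"
      using poset_isos_edges[OF \<tau> edges_carrier[OF uv]] uv by simp
    have "col Q u v = \<sigma> (col P (?\<tau> u) (?\<tau> v))"
      using colored_isosD(2)[OF \<sigma> e] bij_betw_inv_into_right[OF b] edges_carrier[OF uv] by simp
    then show ?thesis
      using bij_betw_inv_into_left[OF b col_carrier[OF P e]] by simp
  qed
qed

lemma colored_isos_monoid_iso:
  fixes P :: "'a colored_poset" and Q :: "'b colored_poset"
  assumes "finitary_colored_upho P" "finitary_colored_upho Q" and \<sigma>: "\<sigma> \<in> colored_isos P Q"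
  shows "\<sigma> \<in> iso (monoid_of P) (monoid_of Q)"
proof -
  interpret P: finitary_colored_upho P by fact
  interpret Q: finitary_colored_upho Q by fact
  note f = colored_isosD(1)[OF \<sigma>]
  note b = poset_isosD(1)[OF f]
  let ?\<tau> = "inv_into (carrier P) \<sigma>"
  have "\<sigma> (s \<otimes>\<^bsub>monoid_of P\<^esub> t) = \<sigma> s \<otimes>\<^bsub>monoid_of Q\<^esub> \<sigma> t"
    if s: "s \<in> carrier P" and t: "t \<in> carrier P" for s t
  proof -
    obtain \<phi> where \<phi>: "\<phi> \<in> shift_isos P s" using P.shift_isos_ex[OF s] .
    have \<sigma>s: "\<sigma> s \<in> carrier Q" using poset_isosD(3)[OF f s] .
    have \<tau>s: "?\<tau> (\<sigma> s) = s" using bij_betw_inv_into_left[OF b s] .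
    have \<tau>: "?\<tau> \<in> poset_isos (above Q (\<sigma> s)) (above P s)"
      using poset_isos_above[OF poset_isos_inv[OF f] \<sigma>s] \<tau>s by simp
    have \<tau>\<phi>: "\<phi> \<circ> ?\<tau> \<in> poset_isos (above Q (\<sigma> s)) P"
      using \<tau> shift_isosD(1)[OF \<phi>] by (rule poset_isos_comp)
    have sh: "\<sigma> \<circ> (\<phi> \<circ> ?\<tau>) \<in> shift_isos Q (\<sigma> s)"
    proof (rule shift_isosI)
      show "\<sigma> \<circ> (\<phi> \<circ> ?\<tau>) \<in> poset_isos (above Q (\<sigma> s)) Q"
        using \<tau>\<phi> f by (rule poset_isos_comp)
      show "col Q ((\<sigma> \<circ> (\<phi> \<circ> ?\<tau>)) u) ((\<sigma> \<circ> (\<phi> \<circ> ?\<tau>)) v) = col Q u v"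
        if uv: "(u, v) \<in> edges (above Q (\<sigma> s))" for u v
      proof -
        have uvQ: "(u, v) \<in> edges Q" using uv by (simp add: edges_above[OF Q.poset])
        have e: "(?\<tau> u, ?\<tau> v) \<in> edges (above P s)"
          using poset_isos_edges[OF \<tau> edges_carrier[OF uv]] uv by simp
        have e': "(?\<tau> u, ?\<tau> v) \<in> edges P" using e by (simp add: edges_above[OF P.poset])
        have e'': "(\<phi> (?\<tau> u), \<phi> (?\<tau> v)) \<in> edges P"
          using poset_isos_edges[OF \<tau>\<phi> edges_carrier[OF uv]] uv by simp
        \<comment> \<open>\<open>\<phi>\<close> keeps colors fixed while \<open>\<sigma>\<close>
          transports them. Both edges of \<open>Q\<close> are images under \<open>\<sigma>\<close>
          of equally colored edges of \<open>P\<close>.\<close>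
        have "col Q (\<sigma> (\<phi> (?\<tau> u))) (\<sigma> (\<phi> (?\<tau> v))) = \<sigma> (col P (?\<tau> u) (?\<tau> v))"
          using colored_isosD(2)[OF \<sigma> e''] shift_isosD(2)[OF \<phi> e] by simp
        also have "\<dots> = col Q u v"
          using colored_isosD(2)[OF \<sigma> e'] bij_betw_inv_into_right[OF b] edges_carrier[OF uvQ] by simp
        finally show ?thesis by simp
      qed
    qed
    note st = P.mult_shift_isos[OF \<phi> s t]
    have c: "s \<otimes>\<^bsub>monoid_of P\<^esub> t \<in> carrier P" using P.mult_closed[OF s t] .
    have "\<sigma> (s \<otimes>\<^bsub>monoid_of P\<^esub> t) \<in> carrier (above Q (\<sigma> s))"
      using poset_isosD(3)[OF poset_isos_above[OF f s] st(1)] .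
    \<comment> \<open>The conjugated map sends the image of the product to
      \<open>\<sigma> t\<close>.\<close>
    from Q.mult_shift_isos_eq[OF sh \<sigma>s this] show ?thesis
      using bij_betw_inv_into_left[OF b c] st(2) by simp
  qed
  then show ?thesis using b poset_isosD(3)[OF f] by (auto simp: iso_def hom_def)
qed

section \<open>Isomorphisms of monoids\<close>

lemma isoD:
  assumes "\<sigma> \<in> iso M N"
  shows "bij_betw \<sigma> (carrier M) (carrier N)" "\<sigma> ` carrier M = carrier N"
    "x \<in> carrier M \<Longrightarrow> \<sigma> x \<in> carrier N"
    "x \<in> carrier M \<Longrightarrow> y \<in> carrier M \<Longrightarrow> \<sigma> (x \<otimes>\<^bsub>M\<^esub> y) = \<sigma> x \<otimes>\<^bsub>N\<^esub> \<sigma> y"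
    "x \<in> carrier M \<Longrightarrow> y \<in> carrier M \<Longrightarrow> \<sigma> x = \<sigma> y \<longleftrightarrow> x = y"
  using assms by (auto simp: iso_def hom_def bij_betw_def inj_on_def)

lemma monoid_iso_inv:
  assumes "monoid M" and \<sigma>: "\<sigma> \<in> iso M N"
  shows "inv_into (carrier M) \<sigma> \<in> iso N M"
proof -
  interpret monoid M by fact
  let ?\<tau> = "inv_into (carrier M) \<sigma>"
  note b = isoD(1)[OF \<sigma>]
  have "?\<tau> (x \<otimes>\<^bsub>N\<^esub> y) = ?\<tau> x \<otimes>\<^bsub>M\<^esub> ?\<tau> y" if xy: "x \<in> carrier N" "y \<in> carrier N" for x y
  proof -
    have \<tau>: "?\<tau> x \<in> carrier M" "?\<tau> y \<in> carrier M"
      using xy bij_betw_apply[OF bij_betw_inv_into[OF b]] by auto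
    then have "\<sigma> (?\<tau> x \<otimes>\<^bsub>M\<^esub> ?\<tau> y) = x \<otimes>\<^bsub>N\<^esub> y"
      using isoD(4)[OF \<sigma> \<tau>] bij_betw_inv_into_right[OF b] xy by simp
    then show ?thesis using bij_betw_inv_into_left[OF b m_closed[OF \<tau>]] by simp
  qed
  then show ?thesis
    using bij_betw_inv_into[OF b] by (auto simp: iso_def hom_def bij_betw_apply)
qed

text \<open>\<open>iso\<close> speaks only of products, so the unit comes from surjectivity: if
  \<open>\<sigma> x\<close> is the unit of \<open>N\<close>, applying \<open>\<sigma>\<close> to the
  product of the unit of \<open>M\<close> with \<open>x\<close> identifies the image of that
  unit.\<close>

lemma monoid_iso_one:
  assumes "monoid M" "monoid N" and \<sigma>: "\<sigma> \<in> iso M N"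
  shows "\<sigma> \<one>\<^bsub>M\<^esub> = \<one>\<^bsub>N\<^esub>"
proof -
  interpret M: monoid M by fact
  interpret N: monoid N by fact
  obtain x where "x \<in> carrier M" "\<sigma> x = \<one>\<^bsub>N\<^esub>" using isoD(2)[OF \<sigma>] N.one_closed by (metis imageE)
  then show ?thesis
    using isoD(4)[OF \<sigma> M.one_closed, of x] isoD(3)[OF \<sigma> M.one_closed] by simp
qed

lemma monoid_iso_Units:
  assumes "monoid M" "monoid N" and \<sigma>: "\<sigma> \<in> iso M N" and x: "x \<in> carrier M"
  shows "\<sigma> x \<in> Units N \<longleftrightarrow> x \<in> Units M"
proof -
  interpret M: monoid M by fact
  have "(\<sigma> y \<otimes>\<^bsub>N\<^esub> \<sigma> x = \<one>\<^bsub>N\<^esub> \<longleftrightarrow> y \<otimes>\<^bsub>M\<^esub> x = \<one>\<^bsub>M\<^esub>) \<and> (\<sigma> x \<otimes>\<^bsub>N\<^esub> \<sigma> y = \<one>\<^bsub>N\<^esub> \<longleftrightarrow> x \<otimes>\<^bsub>M\<^esub> y = \<one>\<^bsub>M\<^esub>)"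
    if y: "y \<in> carrier M" for y
    using x y isoD(4)[OF \<sigma> x y] isoD(4)[OF \<sigma> y x] monoid_iso_one[OF assms(1-3)]
      isoD(5)[OF \<sigma> M.m_closed M.one_closed] by metis
  then show ?thesis
    using x isoD(3)[OF \<sigma> x] unfolding Units_def isoD(2)[OF \<sigma>, symmetric] by simp
qed

lemma monoid_iso_irreducibles:
  assumes "monoid M" "monoid N" and \<sigma>: "\<sigma> \<in> iso M N" and x: "x \<in> carrier M"
  shows "\<sigma> x \<in> irreducibles N \<longleftrightarrow> x \<in> irreducibles M"
proof -
  interpret M: monoid M by fact
  note U = monoid_iso_Units[OF assms(1-3)]
  have "carrier N - Units N = \<sigma> ` (carrier M - Units M)"
    unfolding isoD(2)[OF \<sigma>, symmetric] using U by auto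
  moreover have "\<sigma> x = \<sigma> b \<otimes>\<^bsub>N\<^esub> \<sigma> c \<longleftrightarrow> x = b \<otimes>\<^bsub>M\<^esub> c" if "b \<in> carrier M" "c \<in> carrier M" for b c
    using that x isoD(4)[OF \<sigma> that] isoD(5)[OF \<sigma> x M.m_closed] by metis
  ultimately show ?thesis
    using x isoD(3)[OF \<sigma> x] U[OF x] unfolding irreducibles_def by auto
qed

lemma monoid_iso_list_prod:
  assumes "monoid M" "monoid N" and \<sigma>: "\<sigma> \<in> iso M N" and as: "set as \<subseteq> carrier M"
  shows "\<sigma> (list_prod M as) = list_prod N (map \<sigma> as)"
proof -
  interpret M: monoid M by fact
  have "set as \<subseteq> carrier M \<Longrightarrow> list_prod M as \<in> carrier M \<and> \<sigma> (list_prod M as) = list_prod N (map \<sigma> as)"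
    by (induction as) (auto simp: isoD(4)[OF \<sigma>] monoid_iso_one[OF assms(1-3)])
  then show ?thesis using as by simp
qed

lemma atomic_monoid_iso:
  assumes M: "monoid M" and N: "monoid N" and \<sigma>: "\<sigma> \<in> iso M N" and "atomic M"
  shows "atomic N"
  unfolding atomic_def isoD(2)[OF \<sigma>, symmetric]
proof clarify
  fix x assume "x \<in> carrier M"
  then obtain as where as: "set as \<subseteq> irreducibles M" "list_prod M as = x"
    using assms(4) by (auto simp: atomic_def)
  have ac: "set as \<subseteq> carrier M" using as(1) by (auto simp: irreducibles_def)
  then have "set (map \<sigma> as) \<subseteq> irreducibles N"
    using monoid_iso_irreducibles[OF M N \<sigma>] as(1) by auto
  then show "\<exists>bs. set bs \<subseteq> irreducibles N \<and> list_prod N bs = \<sigma> x"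
    using monoid_iso_list_prod[OF M N \<sigma> ac] as(2) by metis
qed

lemma lcif_monoid_iso:
  assumes "lcif_monoid M" and N: "monoid N" and \<sigma>: "\<sigma> \<in> iso M N"
  shows "lcif_monoid N"
proof -
  interpret M: lcif_monoid M by fact
  note one = monoid_iso_one[OF M.monoid_axioms N \<sigma>]
  show ?thesis
  proof (intro lcif_monoid.intro N lcif_monoid_axioms.intro)
    show "left_cancellative N"
      unfolding left_cancellative_def isoD(2)[OF \<sigma>, symmetric]
    proof clarify
      fix a x y assume c: "a \<in> carrier M" "x \<in> carrier M" "y \<in> carrier M"
        and eq: "\<sigma> a \<otimes>\<^bsub>N\<^esub> \<sigma> x = \<sigma> a \<otimes>\<^bsub>N\<^esub> \<sigma> y"
      then have "a \<otimes>\<^bsub>M\<^esub> x = a \<otimes>\<^bsub>M\<^esub> y"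
        using isoD(4)[OF \<sigma>] isoD(5)[OF \<sigma> M.m_closed M.m_closed] by metis
      then show "\<sigma> x = \<sigma> y" using c M.left_cancel by simp
    qed
    show "invertible_free N"
      unfolding invertible_free_def isoD(2)[OF \<sigma>, symmetric]
    proof (intro ballI impI)
      fix u v assume "u \<in> \<sigma> ` carrier M" "v \<in> \<sigma> ` carrier M" and eq: "u \<otimes>\<^bsub>N\<^esub> v = \<one>\<^bsub>N\<^esub>"
      then obtain x y where c: "x \<in> carrier M" "y \<in> carrier M" and uv: "u = \<sigma> x" "v = \<sigma> y"
        by blast
      then have "x \<otimes>\<^bsub>M\<^esub> y = \<one>\<^bsub>M\<^esub>"
        using eq one isoD(4)[OF \<sigma>] isoD(5)[OF \<sigma> M.m_closed M.one_closed] by metis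
      then show "u = \<one>\<^bsub>N\<^esub> \<and> v = \<one>\<^bsub>N\<^esub>" using c uv one M.mult_eq_one by simp
    qed
  qed
qed

lemma monoid_iso_colored_isos:
  fixes M :: "'a monoid" and N :: "'b monoid"
  assumes "lcif_monoid M" "lcif_monoid N" and \<sigma>: "\<sigma> \<in> iso M N"
  shows "\<sigma> \<in> colored_isos (poset_of M) (poset_of N)"
proof (rule colored_isosI)
  interpret M: lcif_monoid M by fact
  interpret N: lcif_monoid N by fact
  have "(\<sigma> x, \<sigma> y) \<in> leq (poset_of N) \<longleftrightarrow> (x, y) \<in> leq (poset_of M)"
    if xy: "x \<in> carrier M" "y \<in> carrier M" for x y
  proof -
    have "\<sigma> x \<otimes>\<^bsub>N\<^esub> \<sigma> c = \<sigma> y \<longleftrightarrow> x \<otimes>\<^bsub>M\<^esub> c = y" if "c \<in> carrier M" for c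
      using xy that isoD(4)[OF \<sigma> xy(1) that] isoD(5)[OF \<sigma> M.m_closed xy(2)] by metis
    then show ?thesis
      using xy isoD(3)[OF \<sigma>] unfolding leq_poset_of isoD(2)[OF \<sigma>, symmetric] by auto
  qed
  then show "\<sigma> \<in> poset_isos (poset_of M) (poset_of N)"
    using isoD(1)[OF \<sigma>] by (simp add: poset_isos_def)
  show "col (poset_of N) (\<sigma> u) (\<sigma> v) = \<sigma> (col (poset_of M) u v)"
    if uv: "(u, v) \<in> edges (poset_of M)" for u v
  proof -
    obtain c where c: "u \<in> carrier M" "c \<in> irreducibles M" "v = u \<otimes>\<^bsub>M\<^esub> c"
      using uv by (auto simp: M.edges_poset_of)
    have "\<sigma> c \<in> irreducibles N"
      using monoid_iso_irreducibles[OF M.monoid_axioms N.monoid_axioms \<sigma>]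
        M.irreducibles_carrier[OF c(2)] c(2) by simp
    then show ?thesis
      using c M.irreducibles_carrier[OF c(2)] isoD(3,4)[OF \<sigma>] M.col_poset_of N.col_poset_of
      by simp
  qed
qed

section \<open>Gradings and homogeneity\<close>

context lcif_monoid
begin

text \<open>Factoring the cofactor of \<open>b\<close> over \<open>a\<close> into irreducibles gives
  a saturated chain between them.\<close>

lemma leq_imp_relpow:
  assumes "atomic M" "(a, b) \<in> leq (poset_of M)"
  shows "\<exists>k. (a, b) \<in> edges (poset_of M) ^^ k"
proof -
  obtain c where c: "a \<in> carrier M" "c \<in> carrier M" "b = a \<otimes> c"
    using assms(2) unfolding leq_poset_of by metis
  then obtain as where "set as \<subseteq> irreducibles M" "list_prod M as = c"
    using assms(1) by (auto simp: atomic_def)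
  then show ?thesis using c relpow_edges_poset_of[OF c(1)] by blast
qed

lemma relpow_imp_leq:
  assumes "a \<in> carrier M" "(a, b) \<in> edges (poset_of M) ^^ k"
  shows "(a, b) \<in> leq (poset_of M)"
  using assms relpow_edges_poset_of[OF assms(1)] list_prod_irreducibles_closed
  by (auto simp: leq_poset_of)

text \<open>Length is additive along saturated chains, hence injective on any chain. On a maximal
  chain its values form an initial segment of the naturals, so the chain can be enumerated by
  length.\<close>

lemma homogeneous_imp_grading:
  assumes hom: "homogeneous M"
  shows "is_grading (poset_of M) (\<lambda>i. {x. (\<one>, x) \<in> edges (poset_of M) ^^ i})"
proof -
  let ?E = "edges (poset_of M)" and ?le = "\<lambda>x y. (x, y) \<in> leq (poset_of M)"
  have at: "atomic M" and uniq: "(\<one>, x) \<in> ?E ^^ m \<Longrightarrow> (\<one>, x) \<in> ?E ^^ n \<Longrightarrow> m = n" for x m n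
    using hom by (auto simp: homogeneous_iff)
  have pos: "poset (poset_of M)" by (rule poset_poset_of)
  \<comment> \<open>By \<open>uniq\<close> the choice is forced: this is the common length of all
    factorizations of \<open>x\<close> into irreducibles.\<close>
  define len where "len x = (SOME n. (\<one>, x) \<in> ?E ^^ n)" for x
  have len: "(\<one>, x) \<in> ?E ^^ len x" if "x \<in> carrier M" for x
  proof -
    have "(\<one>, x) \<in> leq (poset_of M)" using that by (auto simp: leq_poset_of)
    from leq_imp_relpow[OF at this] show ?thesis unfolding len_def by (rule someI_ex)
  qed
  have rel_carrier: "b \<in> carrier M" if "a \<in> carrier M" "(a, b) \<in> ?E ^^ k" for a b k
    using relpow_imp_leq[OF that] by (simp add: leq_poset_of)
  have len_eq: "len x = n" if "(\<one>, x) \<in> ?E ^^ n" for x n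
    using uniq[OF len that] rel_carrier[OF one_closed that] by simp
  have len_add: "len b = len a + k" if "a \<in> carrier M" "(a, b) \<in> ?E ^^ k" for a b k
    using len[OF that(1)] that(2) by (intro len_eq relpow_trans)
  have len_mono: "len a < len b \<or> a = b" if le: "?le a b" for a b
  proof -
    obtain k where k: "(a, b) \<in> ?E ^^ k" using leq_imp_relpow[OF at le] by blast
    have "a \<in> carrier M" using le by (simp add: leq_poset_of)
    from len_add[OF this k] show ?thesis using k by (cases k) auto
  qed
  have chain: "\<exists>I p. (I = UNIV \<or> (\<exists>n. I = {..n})) \<and> C = p ` I
      \<and> (\<forall>i\<in>I. p i \<in> {x. (\<one>, x) \<in> ?E ^^ i}) \<and> (\<forall>i. Suc i \<in> I \<longrightarrow> (p i, p (Suc i)) \<in> ?E)"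
    if C: "pred_on.maxchain (carrier (poset_of M)) ?le C" for C
  proof -
    have CM: "C \<subseteq> carrier M" and tot: "\<And>x y. x \<in> C \<Longrightarrow> y \<in> C \<Longrightarrow> ?le x y \<or> ?le y x"
      using C unfolding pred_on.maxchain_def poset_chain_iff[OF pos] by auto
    have max: "z \<in> C" if z: "z \<in> carrier M" "\<And>w. w \<in> C \<Longrightarrow> ?le z w \<or> ?le w z" for z
    proof (rule ccontr)
      assume "z \<notin> C"
      have "pred_on.chain (carrier (poset_of M)) ?le (insert z C)"
        unfolding poset_chain_iff[OF pos]
        using CM tot z poset_refl[OF pos, of z] by auto
      moreover have "C \<subset> insert z C" using \<open>z \<notin> C\<close> by blast
      ultimately show False using C unfolding pred_on.maxchain_def by blast
    qed
    have le: "?le x y" if "x \<in> C" "y \<in> C" "len x \<le> len y" for x y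
      using tot[OF that(1,2)] len_mono[of y x] that(3) poset_refl[OF pos, of y] CM that(2) by auto
    have inj: "inj_on len C"
      using le len_mono by (intro inj_onI) (metis less_irrefl order_refl)
    have one: "\<one> \<in> C" using CM by (intro max) (auto simp: leq_poset_of)
    \<comment> \<open>No length is skipped: take \<open>x\<close> in \<open>C\<close> of greatest
      length at most \<open>k\<close>, and the first element \<open>z\<close> on a saturated chain
      from \<open>x\<close> to \<open>y\<close>. It turns out to lie in \<open>C\<close>, so by the
      choice of \<open>x\<close> its length exceeds \<open>k\<close>, and \<open>x\<close> has
      length exactly \<open>k\<close>.\<close>
    have step: "k \<in> len ` C" if k: "Suc k \<in> len ` C" for k
    proof -
      obtain y where y: "y \<in> C" "len y = Suc k" using k by (metis imageE)
      have "len \<one> = 0" by (rule len_eq) simp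
      then obtain x where x: "x \<in> C" "len x \<le> k"
        and xmax: "\<And>w. w \<in> C \<Longrightarrow> len w \<le> k \<Longrightarrow> len w \<le> len x"
        using ex_has_greatest_nat[of "\<lambda>x. x \<in> C \<and> len x \<le> k" \<one> len "Suc k"] one by auto
      have "?le x y" using le[OF x(1) y(1)] x(2) y(2) by simp
      then obtain j where j: "(x, y) \<in> ?E ^^ j" using leq_imp_relpow[OF at] by blast
      have xM: "x \<in> carrier M" using x(1) CM by blast
      have "j \<noteq> 0" using len_add[OF xM j] x(2) y(2) by auto
      then obtain j' where "j = Suc j'" by (cases j) auto
      then obtain z where z: "(x, z) \<in> ?E" "(z, y) \<in> ?E ^^ j'"
        using relpow_Suc_D2[of x y j'] j by blast
      have zM: "z \<in> carrier M" using edges_carrier(2)[OF z(1)] by simp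
      have xz: "?le x z" using edges_leq[OF z(1)] .
      have zy: "?le z y" using relpow_imp_leq[OF zM z(2)] .
      have lz: "len z = Suc (len x)" using len_add[OF xM, of z 1] z(1) by simp
      have "z \<in> C"
      \<comment> \<open>Elements of \<open>C\<close> of length at most \<open>k\<close> lie below
        \<open>x\<close>, and all others lie above \<open>y\<close>, so \<open>z\<close> is
        comparable with each of them.\<close>
      proof (rule max[OF zM])
        fix w assume w: "w \<in> C"
        show "?le z w \<or> ?le w z"
        proof (cases "len w \<le> k")
          case True
          then show ?thesis using poset_trans[OF pos le[OF w x(1)] xz] xmax[OF w] by blast
        next
          case False
          then show ?thesis using poset_trans[OF pos zy le[OF y(1) w]] y(2) by simp
        qed
      qed
      then have "\<not> len z \<le> k" using xmax[of z] lz by auto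
      then have "len x = k" using x(2) lz by simp
      then show ?thesis using x(1) by blast
    qed
    define I where "I = len ` C"
    define p where "p = inv_into C len"
    have down: "i \<in> I" if "i \<le> n" "n \<in> I" for i n
      using that by (induction rule: inc_induct) (use step in \<open>auto simp: I_def\<close>)
    have init: "I = UNIV \<or> (\<exists>n. I = {..n})"
    proof (cases "finite I")
      case True
      moreover have "I \<noteq> {}" using one by (auto simp: I_def)
      ultimately have "I = {..Max I}" using down Max_in by (auto intro: Max_ge)
      then show ?thesis by blast
    next
      case False
      \<comment> \<open>An unbounded downward closed set of naturals contains every natural.\<close>
      then have "n \<in> I" for n
        using down[of n] unfolding finite_nat_set_iff_bounded_le by (meson nat_le_linear)
      then show ?thesis by blast
    qed
    have pI: "p i \<in> C" "len (p i) = i" if "i \<in> I" for i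
      using that by (auto simp: p_def I_def inv_into_into f_inv_into_f)
    moreover have "p (len x) = x" if "x \<in> C" for x
      using that inj by (simp add: p_def)
    then have "C = p ` I" using pI by (force simp: I_def)
    moreover have "p i \<in> {x. (\<one>, x) \<in> ?E ^^ i}" if "i \<in> I" for i
      using len[of "p i"] pI[OF that] CM by auto
    moreover have "(p i, p (Suc i)) \<in> ?E" if "Suc i \<in> I" for i
    proof -
      have i: "i \<in> I" using down[of i "Suc i"] that by simp
      have "?le (p i) (p (Suc i))" using le pI[OF i] pI[OF that] by simp
      then obtain k where k: "(p i, p (Suc i)) \<in> ?E ^^ k" using leq_imp_relpow[OF at] by blast
      \<comment> \<open>The lengths of the endpoints are \<open>i\<close> and \<open>Suc i\<close>,
        so the connecting chain is a single edge.\<close>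
      then have "k = 1" using len_add[OF _ k] pI[OF i] pI[OF that] CM by auto
      then show ?thesis using k by simp
    qed
    ultimately show ?thesis using init by (intro exI[of _ I] exI[of _ p] conjI ballI allI impI)
  qed
  show ?thesis
    unfolding is_grading_def
  proof (intro conjI allI impI)
    show "carrier (poset_of M) = (\<Union>i. {x. (\<one>, x) \<in> ?E ^^ i})"
      using len rel_carrier[OF one_closed] by auto
    show "disjoint_family (\<lambda>i. {x. (\<one>, x) \<in> ?E ^^ i})"
      using uniq by (auto simp: disjoint_family_on_def)
  qed (rule chain)
qed

lemma grading_imp_homogeneous:
  assumes "is_grading (poset_of M) R"
  shows "homogeneous M"
  unfolding homogeneous_iff
proof (intro conjI allI impI)
  have u: "upho (poset_of M)" using colored_upho_poset_of by (simp add: colored_upho_def)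
  show "atomic M"
    using N_graded_imp_finitary[OF u] assms finitary_poset_of by (auto simp: N_graded_def)
  fix x m n
  assume "(\<one>, x) \<in> edges (poset_of M) ^^ m" "(\<one>, x) \<in> edges (poset_of M) ^^ n"
  then have "x \<in> R m" "x \<in> R n"
    using grading_relpow[OF u assms] by (simp_all add: least_poset_of)
  moreover have "disjoint_family R" using assms by (simp add: is_grading_def)
  ultimately show "m = n" by (auto simp: disjoint_family_on_def)
qed

lemma N_graded_iff: "N_graded (poset_of M) \<longleftrightarrow> homogeneous M"
  using homogeneous_imp_grading grading_imp_homogeneous by (auto simp: N_graded_def)

text \<open>At each split of the product one side is trivial: either the head is \<open>a\<close>
  itself, or it is \<open>\<one>\<close> and the tail still multiplies to \<open>a\<close>. Every
  generating set therefore contains all irreducibles.\<close>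

lemma irreducibles_subset_generators:
  assumes "a \<in> irreducibles M" "set as \<subseteq> carrier M" "list_prod M as = a"
  shows "a \<in> set as"
  using assms
proof (induction as)
  case Nil
  then show ?case by (simp add: irreducible_iff)
next
  case (Cons b bs)
  have c: "b \<in> carrier M" "list_prod M bs \<in> carrier M"
    using Cons.prems(2) list_prod_closed by auto
  then have "b = \<one> \<or> list_prod M bs = \<one>"
    using Cons.prems(1,3) unfolding irreducible_iff by (metis list_prod_Cons)
  then show ?case using Cons c by auto
qed

text \<open>Both sides make the set of irreducibles finite: it lies in rank one of any grading, and
  in any generating set. Conversely, finitely many irreducibles generate an atomic monoid and form
  finitely many words of each length.\<close>

lemma finite_type_iff:
  "finite_type_N_graded (poset_of M) \<longleftrightarrow> finitely_generated M \<and> homogeneous M"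
proof (intro iffI conjI)
  assume "finite_type_N_graded (poset_of M)"
  then obtain R where R: "is_grading (poset_of M) R" "\<And>i. finite (R i)"
    by (auto simp: finite_type_N_graded_def)
  show hom: "homogeneous M" using grading_imp_homogeneous[OF R(1)] .
  have u: "upho (poset_of M)" using colored_upho_poset_of by (simp add: colored_upho_def)
  have "(\<one>, a) \<in> edges (poset_of M) ^^ 1" if "a \<in> irreducibles M" for a
    using that atoms_poset_of by (simp add: atoms_def least_poset_of set_eq_iff)
  then have "irreducibles M \<subseteq> R 1"
    using grading_relpow[OF u R(1), of _ 1] by (auto simp: least_poset_of)
  then have "finite (irreducibles M)" using R(2) finite_subset by blast
  then show "finitely_generated M"
    using hom irreducibles_carrier unfolding finitely_generated_def homogeneous_def atomic_def
    by blast
next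
  assume *: "finitely_generated M \<and> homogeneous M"
  then obtain G where G: "finite G" "G \<subseteq> carrier M"
    "\<And>x. x \<in> carrier M \<Longrightarrow> \<exists>as. set as \<subseteq> G \<and> list_prod M as = x"
    unfolding finitely_generated_def by blast
  have "irreducibles M \<subseteq> G"
  proof
    fix a assume a: "a \<in> irreducibles M"
    then obtain as where as: "set as \<subseteq> G" "list_prod M as = a"
      using G(3) irreducibles_carrier by blast
    then show "a \<in> G" using irreducibles_subset_generators[OF a, of as] G(2) by blast
  qed
  then have fin: "finite (irreducibles M)" using G(1) finite_subset by blast
  have "finite {x. (\<one>, x) \<in> edges (poset_of M) ^^ i}" for i
  proof (rule finite_subset)
    show "{x. (\<one>, x) \<in> edges (poset_of M) ^^ i} \<subseteq>
        list_prod M ` {as. set as \<subseteq> irreducibles M \<and> length as = i}"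
      by (auto simp: relpow_edges_one)
  qed (use finite_lists_length_eq[OF fin] in simp)
  then show "finite_type_N_graded (poset_of M)"
    using homogeneous_imp_grading * unfolding finite_type_N_graded_def by blast
qed

end

text \<open>Concatenating factorizations of \<open>x\<close> and \<open>y\<close> gives one of the
  unit, which also has the empty factorization; equal lengths make both lists empty.\<close>

lemma homogeneous_imp_invertible_free:
  assumes "monoid M" "homogeneous M"
  shows "invertible_free M"
  unfolding invertible_free_def
proof (intro ballI impI)
  interpret monoid M by fact
  fix x y assume xy: "x \<in> carrier M" "y \<in> carrier M" "x \<otimes>\<^bsub>M\<^esub> y = \<one>\<^bsub>M\<^esub>"
  obtain as where as: "set as \<subseteq> irreducibles M" "list_prod M as = x"
    using assms(2) xy(1) unfolding homogeneous_def atomic_def by blast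
  obtain bs where bs: "set bs \<subseteq> irreducibles M" "list_prod M bs = y"
    using assms(2) xy(2) unfolding homogeneous_def atomic_def by blast
  have closed: "list_prod M cs \<in> carrier M" if "set cs \<subseteq> irreducibles M" for cs
    using that by (induction cs) (auto simp: irreducibles_def)
  have "list_prod M (cs @ bs) = list_prod M cs \<otimes>\<^bsub>M\<^esub> list_prod M bs"
    if "set cs \<subseteq> irreducibles M" for cs
    using that closed[OF bs(1)] closed by (induction cs) (auto simp: m_assoc irreducibles_def)
  from this[OF as(1)] have "list_prod M (as @ bs) = list_prod M []" using as bs xy by simp
  moreover have "set (as @ bs) \<subseteq> irreducibles M" using as bs by simp
  ultimately have "length (as @ bs) = length ([] :: 'a list)"
    using assms(2) unfolding homogeneous_def by (metis empty_subsetI list.set(1))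
  then show "x = \<one>\<^bsub>M\<^esub> \<and> y = \<one>\<^bsub>M\<^esub>" using as bs by simp
qed

section \<open>Isomorphism classes\<close>

text \<open>All members of the class are sent into one \<open>S\<close>-class, so the union
  collapses to that class.\<close>

lemma on_classes_class:
  assumes R: "equiv U R" and S: "equiv V S" and x: "x \<in> U"
    and cong: "\<And>y. (x, y) \<in> R \<Longrightarrow> (F x, F y) \<in> S"
  shows "on_classes S F (R `` {x}) = S `` {F x}"
proof -
  have "(x, x) \<in> R" using R x by (auto simp: equiv_def refl_on_def)
  have "S `` {F y} = S `` {F x}" if "(x, y) \<in> R" for y
    using equiv_class_eq[OF S cong[OF that]] by simp
  then have "on_classes S F (R `` {x}) = (\<Union>y\<in>R `` {x}. S `` {F x})"
    unfolding on_classes_def by (intro SUP_cong) auto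
  also have "\<dots> = S `` {F x}" using \<open>(x, x) \<in> R\<close> by blast
  finally show ?thesis .
qed

text \<open>Compatibility is asked along the whole class of an element of \<open>A\<close>, because
  \<open>on_classes\<close> applies \<open>F\<close> to every member of that class.\<close>

lemma on_classes_inverse:
  assumes R: "equiv U R" and S: "equiv V S" and A: "A \<subseteq> U" and B: "B \<subseteq> V"
    and FA: "\<And>x. x \<in> A \<Longrightarrow> F x \<in> B"
    and F: "\<And>x y. x \<in> A \<Longrightarrow> (x, y) \<in> R \<Longrightarrow> (F x, F y) \<in> S"
    and G: "\<And>x y. x \<in> B \<Longrightarrow> (x, y) \<in> S \<Longrightarrow> (G x, G y) \<in> R"
    and GF: "\<And>x. x \<in> A \<Longrightarrow> (G (F x), x) \<in> R"
    and C: "C \<in> A // R"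
  shows "on_classes S F C \<in> B // S" "on_classes R G (on_classes S F C) = C"
proof -
  obtain x where x: "x \<in> A" and C': "C = R `` {x}" using C by (rule quotientE)
  have F': "on_classes S F C = S `` {F x}"
    unfolding C' using x A F by (intro on_classes_class[OF R S]) auto
  then show "on_classes S F C \<in> B // S" using FA[OF x] by (simp add: quotientI)
  have "on_classes R G (S `` {F x}) = R `` {G (F x)}"
    using FA[OF x] B G by (intro on_classes_class[OF S R]) auto
  then show "on_classes R G (on_classes S F C) = C"
    using F' C' equiv_class_eq[OF R GF[OF x]] by simp
qed

lemma on_classes_bij_betw:
  assumes R: "equiv U R" and S: "equiv V S" and A: "A \<subseteq> U" and B: "B \<subseteq> V"
    and FA: "\<And>x. x \<in> A \<Longrightarrow> F x \<in> B" and GB: "\<And>y. y \<in> B \<Longrightarrow> G y \<in> A"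
    and F: "\<And>x y. x \<in> A \<Longrightarrow> (x, y) \<in> R \<Longrightarrow> (F x, F y) \<in> S"
    and G: "\<And>x y. x \<in> B \<Longrightarrow> (x, y) \<in> S \<Longrightarrow> (G x, G y) \<in> R"
    and GF: "\<And>x. x \<in> A \<Longrightarrow> (G (F x), x) \<in> R" and FG: "\<And>y. y \<in> B \<Longrightarrow> (F (G y), y) \<in> S"
  shows "bij_betw (on_classes S F) (A // R) (B // S)"
  using on_classes_inverse[OF R S A B FA F G GF] on_classes_inverse[OF S R B A GB G F FG]
  by (intro bij_betw_byWitness[where f' = "on_classes R G"]) auto

lemma equiv_upho_iso_rel: "equiv {P. colored_upho P} upho_iso_rel"
proof (rule equivI)
  show "refl_on {P. colored_upho P} upho_iso_rel"
    using colored_isos_refl by (auto simp: refl_on_def upho_iso_rel_def)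
  show "sym upho_iso_rel"
    using colored_isos_inv by (fastforce simp: sym_def upho_iso_rel_def)
  show "trans upho_iso_rel"
    unfolding trans_def upho_iso_rel_def using colored_isos_comp by blast
qed (auto simp: upho_iso_rel_def)

lemma equiv_monoid_iso_rel: "equiv {M. monoid M} monoid_iso_rel"
proof (rule equivI)
  show "refl_on {M. monoid M} monoid_iso_rel"
    by (auto simp: refl_on_def monoid_iso_rel_def)
  show "sym monoid_iso_rel"
    using monoid_iso_inv by (fastforce simp: sym_def monoid_iso_rel_def is_iso_def)
  show "trans monoid_iso_rel"
    by (auto simp: trans_def monoid_iso_rel_def intro: iso_trans)
qed (auto simp: monoid_iso_rel_def)

section \<open>The two classes and the assignments between them\<close>

lemma finitary_colored_uphos_iff: "P \<in> finitary_colored_uphos \<longleftrightarrow> finitary_colored_upho P"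
  by (simp add: finitary_colored_uphos_def finitary_colored_upho_def)

lemma atomic_lcif_monoids_iff: "M \<in> atomic_lcif_monoids \<longleftrightarrow> lcif_monoid M \<and> atomic M"
  by (auto simp: atomic_lcif_monoids_def lcif_monoid_def lcif_monoid_axioms_def)

lemma monoid_of_atomic_lcif:
  "P \<in> finitary_colored_uphos \<Longrightarrow> monoid_of P \<in> atomic_lcif_monoids"
  by (simp add: finitary_colored_uphos_iff atomic_lcif_monoids_iff
      finitary_colored_upho.lcif_monoid finitary_colored_upho.atomic)

lemma poset_of_finitary_colored_upho:
  "M \<in> atomic_lcif_monoids \<Longrightarrow> poset_of M \<in> finitary_colored_uphos"
  by (simp add: finitary_colored_uphos_iff atomic_lcif_monoids_iff
      lcif_monoid.finitary_colored_upho_poset_of)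

text \<open>\<open>upho_iso_rel\<close> relates arbitrary colored upho posets, so finitariness of
  \<open>Q\<close> must be established before \<open>monoid_of Q\<close> is known to be a
  monoid.\<close>

lemma finitary_colored_uphos_closed:
  assumes "P \<in> finitary_colored_uphos" "(P, Q) \<in> upho_iso_rel"
  shows "Q \<in> finitary_colored_uphos"
proof -
  obtain \<sigma> where "\<sigma> \<in> colored_isos P Q" and Q: "colored_upho Q"
    using assms(2) unfolding upho_iso_rel_def by blast
  then have "finitary Q"
    using assms(1) finitary_poset_iso[OF colored_isosD(1)]
    by (auto simp: finitary_colored_uphos_def colored_upho_def upho_def)
  then show ?thesis using Q by (simp add: finitary_colored_uphos_def)
qed

lemma atomic_lcif_monoids_closed:
  assumes "M \<in> atomic_lcif_monoids" "(M, N) \<in> monoid_iso_rel"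
  shows "N \<in> atomic_lcif_monoids"
  using assms lcif_monoid_iso[of M N] atomic_monoid_iso[of M N]
  unfolding monoid_iso_rel_def atomic_lcif_monoids_iff is_iso_def by blast

lemma monoid_of_cong:
  fixes P :: "'a colored_poset" and Q :: "'b colored_poset"
  assumes "P \<in> finitary_colored_uphos" "Q \<in> finitary_colored_uphos" "colored_isos P Q \<noteq> {}"
  shows "monoid_of P \<cong> monoid_of Q"
  using assms colored_isos_monoid_iso unfolding finitary_colored_uphos_iff is_iso_def by blast

lemma poset_of_cong:
  fixes M :: "'a monoid" and N :: "'b monoid"
  assumes "M \<in> atomic_lcif_monoids" "N \<in> atomic_lcif_monoids" "M \<cong> N"
  shows "colored_isos (poset_of M) (poset_of N) \<noteq> {}"
  using assms monoid_iso_colored_isos unfolding atomic_lcif_monoids_iff is_iso_def by blast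

lemma poset_of_monoid_of_rel:
  assumes "P \<in> finitary_colored_uphos"
  shows "(poset_of (monoid_of P), P) \<in> upho_iso_rel"
  using poset_of_finitary_colored_upho[OF monoid_of_atomic_lcif[OF assms]] assms
    finitary_colored_upho.poset_of_monoid_of_iso[of P]
  unfolding upho_iso_rel_def finitary_colored_uphos_iff finitary_colored_upho_def by blast

lemma monoid_of_poset_of_rel:
  assumes "M \<in> atomic_lcif_monoids"
  shows "(monoid_of (poset_of M), M) \<in> monoid_iso_rel"
proof -
  have "monoid_of (poset_of M) \<cong> M"
    using assms lcif_monoid.monoid_of_poset_of_iso is_isoI by (auto simp: atomic_lcif_monoids_iff)
  then show ?thesis
    using monoid_of_atomic_lcif[OF poset_of_finitary_colored_upho[OF assms]] assms
    by (simp add: monoid_iso_rel_def atomic_lcif_monoids_def)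
qed

lemma monoid_of_rel:
  assumes "P \<in> finitary_colored_uphos" "(P, Q) \<in> upho_iso_rel"
  shows "(monoid_of P, monoid_of Q) \<in> monoid_iso_rel"
  using assms(2) monoid_of_atomic_lcif monoid_of_cong assms(1) finitary_colored_uphos_closed[OF assms]
  unfolding monoid_iso_rel_def upho_iso_rel_def atomic_lcif_monoids_def by blast

lemma poset_of_rel:
  assumes "M \<in> atomic_lcif_monoids" "(M, N) \<in> monoid_iso_rel"
  shows "(poset_of M, poset_of N) \<in> upho_iso_rel"
  using assms(2) poset_of_finitary_colored_upho poset_of_cong assms(1) atomic_lcif_monoids_closed[OF assms]
  unfolding monoid_iso_rel_def upho_iso_rel_def finitary_colored_uphos_def by blast

text \<open>The backward direction composes the round trip at \<open>P\<close>, the colored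
  isomorphism induced by the monoid isomorphism, and the round trip at \<open>Q\<close>. Carrier
  types may differ here, whereas the isomorphism relations live on a single type.\<close>

lemma monoid_of_iso_iff:
  fixes P :: "'a colored_poset" and Q :: "'b colored_poset"
  assumes P: "P \<in> finitary_colored_uphos" and Q: "Q \<in> finitary_colored_uphos"
  shows "colored_isos P Q \<noteq> {} \<longleftrightarrow> monoid_of P \<cong> monoid_of Q"
proof
  assume "monoid_of P \<cong> monoid_of Q"
  then obtain \<sigma> where \<sigma>: "\<sigma> \<in> colored_isos (poset_of (monoid_of P)) (poset_of (monoid_of Q))"
    using poset_of_cong[OF monoid_of_atomic_lcif[OF P] monoid_of_atomic_lcif[OF Q]] by blast
  obtain \<tau> where \<tau>: "\<tau> \<in> colored_isos P (poset_of (monoid_of P))"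
    using poset_of_monoid_of_rel[OF P] colored_isos_inv[of _ _ P]
    unfolding upho_iso_rel_def by blast
  obtain \<rho> where "\<rho> \<in> colored_isos (poset_of (monoid_of Q)) Q"
    using poset_of_monoid_of_rel[OF Q] by (auto simp: upho_iso_rel_def)
  then show "colored_isos P Q \<noteq> {}"
    using colored_isos_comp[OF colored_isos_comp[OF \<tau> \<sigma>]] by blast
qed (rule monoid_of_cong[OF P Q])

lemma poset_of_iso_iff:
  fixes M :: "'a monoid" and N :: "'b monoid"
  assumes M: "M \<in> atomic_lcif_monoids" and N: "N \<in> atomic_lcif_monoids"
  shows "M \<cong> N \<longleftrightarrow> colored_isos (poset_of M) (poset_of N) \<noteq> {}"
proof
  assume "colored_isos (poset_of M) (poset_of N) \<noteq> {}"
  then have "monoid_of (poset_of M) \<cong> monoid_of (poset_of N)"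
    by (intro monoid_of_cong poset_of_finitary_colored_upho M N)
  moreover have "M \<cong> monoid_of (poset_of M)"
    using monoid_of_poset_of_rel[OF M] equiv_monoid_iso_rel
    unfolding equiv_def sym_def monoid_iso_rel_def by blast
  moreover have "monoid_of (poset_of N) \<cong> N"
    using monoid_of_poset_of_rel[OF N] by (simp add: monoid_iso_rel_def)
  ultimately show "M \<cong> N" by (metis iso_trans)
qed (rule poset_of_cong[OF M N])

section \<open>The graded subclasses\<close>

lemma N_graded_subset: "N_graded_colored_uphos \<subseteq> finitary_colored_uphos"
  using N_graded_imp_finitary
  by (auto simp: N_graded_colored_uphos_def finitary_colored_uphos_def colored_upho_def)

lemma finite_type_subset: "finite_type_N_graded_colored_uphos \<subseteq> N_graded_colored_uphos"
  by (auto simp: finite_type_N_graded_colored_uphos_def N_graded_colored_uphos_def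
      finite_type_N_graded_def N_graded_def)

lemma homogeneous_subset: "homogeneous_lc_monoids \<subseteq> atomic_lcif_monoids"
  using homogeneous_imp_invertible_free
  by (auto simp: homogeneous_lc_monoids_def atomic_lcif_monoids_def homogeneous_def)

lemma poset_of_graded_iff:
  assumes "M \<in> atomic_lcif_monoids"
  shows "poset_of M \<in> N_graded_colored_uphos \<longleftrightarrow> M \<in> homogeneous_lc_monoids"
    "poset_of M \<in> finite_type_N_graded_colored_uphos \<longleftrightarrow> M \<in> fg_homogeneous_lc_monoids"
proof -
  interpret lcif_monoid M using assms by (simp add: atomic_lcif_monoids_iff)
  show "poset_of M \<in> N_graded_colored_uphos \<longleftrightarrow> M \<in> homogeneous_lc_monoids"
    "poset_of M \<in> finite_type_N_graded_colored_uphos \<longleftrightarrow> M \<in> fg_homogeneous_lc_monoids"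
    using colored_upho_poset_of monoid_axioms left_cancellative N_graded_iff finite_type_iff
    by (simp_all add: N_graded_colored_uphos_def finite_type_N_graded_colored_uphos_def
        homogeneous_lc_monoids_def fg_homogeneous_lc_monoids_def)
qed

lemma monoid_of_graded_iff:
  assumes P: "P \<in> finitary_colored_uphos"
  shows "monoid_of P \<in> homogeneous_lc_monoids \<longleftrightarrow> P \<in> N_graded_colored_uphos"
    "monoid_of P \<in> fg_homogeneous_lc_monoids \<longleftrightarrow> P \<in> finite_type_N_graded_colored_uphos"
proof -
  interpret finitary_colored_upho P using P by (simp add: finitary_colored_uphos_iff)
  have "colored_upho (poset_of (monoid_of P))"
    using poset_of_finitary_colored_upho[OF monoid_of_atomic_lcif[OF P]]
    by (simp add: finitary_colored_uphos_def)
  then show "monoid_of P \<in> homogeneous_lc_monoids \<longleftrightarrow> P \<in> N_graded_colored_uphos"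
    "monoid_of P \<in> fg_homogeneous_lc_monoids \<longleftrightarrow> P \<in> finite_type_N_graded_colored_uphos"
    using poset_of_graded_iff[OF monoid_of_atomic_lcif[OF P]] poset_of_monoid_of_cong(3,4) colored_upho
    by (simp_all add: N_graded_colored_uphos_def finite_type_N_graded_colored_uphos_def)
qed

text \<open>Parametrized over subclasses so that one argument serves the full classes and both
  graded subclasses.\<close>

lemma monoid_of_bij_betw:
  fixes A :: "'a colored_poset set" and B :: "'a monoid set"
  assumes A: "A \<subseteq> finitary_colored_uphos" and B: "B \<subseteq> atomic_lcif_monoids"
    and FA: "\<And>P. P \<in> A \<Longrightarrow> monoid_of P \<in> B" and GB: "\<And>M. M \<in> B \<Longrightarrow> poset_of M \<in> A"
  shows "bij_betw (on_classes monoid_iso_rel monoid_of) (A // upho_iso_rel) (B // monoid_iso_rel)"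
proof (rule on_classes_bij_betw[OF equiv_upho_iso_rel equiv_monoid_iso_rel])
  show "A \<subseteq> {P. colored_upho P}" using A by (auto simp: finitary_colored_uphos_def)
  show "B \<subseteq> {M. monoid M}" using B by (auto simp: atomic_lcif_monoids_def)
  show "(monoid_of P, monoid_of Q) \<in> monoid_iso_rel" if "P \<in> A" "(P, Q) \<in> upho_iso_rel" for P Q
    using monoid_of_rel that A by blast
  show "(poset_of M, poset_of N) \<in> upho_iso_rel" if "M \<in> B" "(M, N) \<in> monoid_iso_rel" for M N
    using poset_of_rel that B by blast
  show "(poset_of (monoid_of P), P) \<in> upho_iso_rel" if "P \<in> A" for P
    using poset_of_monoid_of_rel that A by blast
  show "(monoid_of (poset_of M), M) \<in> monoid_iso_rel" if "M \<in> B" for M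
    using monoid_of_poset_of_rel that B by blast
qed (fact FA GB)+

theorem theorem1p3:
  shows
    "\<comment> \<open>the assignments are well defined, also on isomorphism classes\<close>
     (\<forall>P \<in> (finitary_colored_uphos :: 'a colored_poset set). monoid_of P \<in> atomic_lcif_monoids) \<and>
     (\<forall>M \<in> (atomic_lcif_monoids :: 'a monoid set). poset_of M \<in> finitary_colored_uphos) \<and>
     (\<forall>P \<in> (finitary_colored_uphos :: 'a colored_poset set).
        \<forall>Q \<in> (finitary_colored_uphos :: 'b colored_poset set).
          colored_isos P Q \<noteq> {} \<longleftrightarrow> is_iso (monoid_of P) (monoid_of Q)) \<and>
     (\<forall>M \<in> (atomic_lcif_monoids :: 'a monoid set). \<forall>N \<in> (atomic_lcif_monoids :: 'b monoid set).
          is_iso M N \<longleftrightarrow> colored_isos (poset_of M) (poset_of N) \<noteq> {}) \<and>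
     \<comment> \<open>they induce mutually inverse bijections on isomorphism classes\<close>
     bij_betw (on_classes monoid_iso_rel monoid_of)
       ((finitary_colored_uphos :: 'a colored_poset set) // upho_iso_rel)
       (atomic_lcif_monoids // monoid_iso_rel) \<and>
     bij_betw (on_classes upho_iso_rel poset_of)
       ((atomic_lcif_monoids :: 'a monoid set) // monoid_iso_rel)
       (finitary_colored_uphos // upho_iso_rel) \<and>
     (\<forall>C \<in> (finitary_colored_uphos :: 'a colored_poset set) // upho_iso_rel.
        on_classes upho_iso_rel poset_of (on_classes monoid_iso_rel monoid_of C) = C) \<and>
     (\<forall>D \<in> (atomic_lcif_monoids :: 'a monoid set) // monoid_iso_rel.
        on_classes monoid_iso_rel monoid_of (on_classes upho_iso_rel poset_of D) = D) \<and>
     \<comment> \<open>they restrict to bijections between the respective subclasses\<close>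
     (N_graded_colored_uphos :: 'a colored_poset set) \<subseteq> finitary_colored_uphos \<and>
     (homogeneous_lc_monoids :: 'a monoid set) \<subseteq> atomic_lcif_monoids \<and>
     bij_betw (on_classes monoid_iso_rel monoid_of)
       ((N_graded_colored_uphos :: 'a colored_poset set) // upho_iso_rel)
       (homogeneous_lc_monoids // monoid_iso_rel) \<and>
     bij_betw (on_classes monoid_iso_rel monoid_of)
       ((finite_type_N_graded_colored_uphos :: 'a colored_poset set) // upho_iso_rel)
       (fg_homogeneous_lc_monoids // monoid_iso_rel)"
proof -
  have U: "finitary_colored_uphos \<subseteq> {P :: 'a colored_poset. colored_upho P}"
    and V: "atomic_lcif_monoids \<subseteq> {M :: 'a monoid. monoid M}"
    by (auto simp: finitary_colored_uphos_def atomic_lcif_monoids_def)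
  note R = equiv_upho_iso_rel and S = equiv_monoid_iso_rel
  have fg: "(fg_homogeneous_lc_monoids :: 'a monoid set) \<subseteq> homogeneous_lc_monoids"
    by (auto simp: fg_homogeneous_lc_monoids_def homogeneous_lc_monoids_def)
  show ?thesis
  proof (intro conjI ballI)
    show "bij_betw (on_classes monoid_iso_rel monoid_of)
       ((finitary_colored_uphos :: 'a colored_poset set) // upho_iso_rel)
       (atomic_lcif_monoids // monoid_iso_rel)"
      by (intro monoid_of_bij_betw order_refl monoid_of_atomic_lcif poset_of_finitary_colored_upho)
    \<comment> \<open>The hypotheses of \<open>on_classes_bij_betw\<close> are symmetric, so
      exchanging the two sides gives the bijection in the other direction.\<close>
    show "bij_betw (on_classes upho_iso_rel poset_of)
       ((atomic_lcif_monoids :: 'a monoid set) // monoid_iso_rel)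
       (finitary_colored_uphos // upho_iso_rel)"
      by (rule on_classes_bij_betw[OF S R V U poset_of_finitary_colored_upho monoid_of_atomic_lcif
            poset_of_rel monoid_of_rel monoid_of_poset_of_rel poset_of_monoid_of_rel])
    show "on_classes upho_iso_rel poset_of (on_classes monoid_iso_rel monoid_of C) = C"
      if "C \<in> (finitary_colored_uphos :: 'a colored_poset set) // upho_iso_rel" for C
      by (rule on_classes_inverse(2)[OF R S U V monoid_of_atomic_lcif monoid_of_rel poset_of_rel
            poset_of_monoid_of_rel that])
    show "on_classes monoid_iso_rel monoid_of (on_classes upho_iso_rel poset_of D) = D"
      if "D \<in> (atomic_lcif_monoids :: 'a monoid set) // monoid_iso_rel" for D
      by (rule on_classes_inverse(2)[OF S R V U poset_of_finitary_colored_upho poset_of_rel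
            monoid_of_rel monoid_of_poset_of_rel that])
    show "bij_betw (on_classes monoid_iso_rel monoid_of)
       ((N_graded_colored_uphos :: 'a colored_poset set) // upho_iso_rel)
       (homogeneous_lc_monoids // monoid_iso_rel)"
      using N_graded_subset homogeneous_subset monoid_of_graded_iff(1) poset_of_graded_iff(1)
      by (intro monoid_of_bij_betw) blast+
    show "bij_betw (on_classes monoid_iso_rel monoid_of)
       ((finite_type_N_graded_colored_uphos :: 'a colored_poset set) // upho_iso_rel)
       (fg_homogeneous_lc_monoids // monoid_iso_rel)"
      using N_graded_subset finite_type_subset homogeneous_subset fg
        monoid_of_graded_iff(2) poset_of_graded_iff(2)
      by (intro monoid_of_bij_betw) blast+
  qed ((rule monoid_of_atomic_lcif poset_of_finitary_colored_upho monoid_of_iso_iff poset_of_iso_iff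
      N_graded_subset homogeneous_subset; assumption)+)
qed

end
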